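(* Let $d,n\ge 1$, $\sigma>0$, let $\mathbf M\in\mathbb R^{d\times d}$ be symmetric positive definite, let $\mathbf S,\mathbf T\in\mathbb R^{d\times d}$ be symmetric positive semi-definite, and let $W=\{\mathbf w\in\mathbb R^d:\mathbf w^\top\mathbf M\mathbf w\le 1\}$. Then $$\inf_{\hat{\mathbf w}}\ \sup_{(P,Q)\in\mathcal P(W,\mathbf S,\mathbf T)}\ \mathbb E\big\|\hat{\mathbf w}-\mathbf w^*\big\|_{\mathbf T}^2\ \ge\ \sup_{\substack{\mathbf F\succ \mathbf 0\\ \operatorname{tr}\mathbf F\le 1/\pi^2}}\Big\langle \mathbf T',\Big(\mathbf F^{-1}+\frac{n}{\sigma^2}\mathbf S'\Big)^{-1}\Big\rangle,$$ where the infimum is over all (possibly randomized) estimators $\hat{\mathbf w}=\hat{\mathbf w}(\{(\mathbf x_i,y_i)\}_{i=1}^n,\xi)$, the expectation is over $n$ i.i.d. samples $(\mathbf x_i,y_i)\sim P$ and the independent randomization $\xi$, and the supremum on the right is over symmetric positive definite $\mathbf F$.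
   Context: Notation: $\|\mathbf w\|_{\mathbf A}^2=\mathbf w^\top\mathbf A\mathbf w$; $\langle\mathbf A,\mathbf B\rangle=\operatorname{tr}(\mathbf A^\top\mathbf B)$; $\mathbf S'=\mathbf M^{-1/2}\mathbf S\mathbf M^{-1/2}$, $\mathbf T'=\mathbf M^{-1/2}\mathbf T\mathbf M^{-1/2}$. Problem class $\mathcal P(W,\mathbf S,\mathbf T)$: all pairs $(P,Q)$ of probability distributions of $(\mathbf x,y)\in\mathbb R^d\times\mathbb R$ with finite second moments (source $P$, target $Q$) such that (i) $\mathbb E_P[\mathbf x\mathbf x^\top]=\mathbf S$ and $\mathbb E_Q[\mathbf x\mathbf x^\top]=\mathbf T$; (ii) the source risk $\frac12\mathbb E_P(y-\langle\mathbf w,\mathbf x\rangle)^2$ and target risk $\frac12\mathbb E_Q(y-\langle\mathbf w,\mathbf x\rangle)^2$ admit a common minimizer $\mathbf w^*$, and $\mathbf w^*\in W$ (this $\mathbf w^*$ is the one appearing in the risk); (iii) with $\epsilon=y-\mathbf x^\top\mathbf w^*$, $\mathbb E_P[\epsilon^2\mathbf x\mathbf x^\top]\preceq\sigma^2\mathbf S$. (The paper also requires $\sup_{\mathbf w\in W}\|\mathbf w\|_{\mathbf S}^2\le c$ for a constant $c$, which holds with $c=\|\mathbf S'\|$.) A randomized estimator is a measurable function of the $n$ samples and of an auxiliary random variable $\xi$ independent of the samples whose law does not depend on $(P,Q)$. *)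

theory Defs
  imports "HOL-Analysis.Analysis" "HOL-Probability.Probability"
begin

definition psd_mat :: "real^'d^'d \<Rightarrow> bool" where
  "psd_mat A \<longleftrightarrow> transpose A = A \<and> (\<forall>v. 0 \<le> v \<bullet> (A *v v))"

definition pd_mat :: "real^'d^'d \<Rightarrow> bool" where
  "pd_mat A \<longleftrightarrow> transpose A = A \<and> (\<forall>v. v \<noteq> 0 \<longrightarrow> 0 < v \<bullet> (A *v v))"

definition mat_sqrt :: "real^'d^'d \<Rightarrow> real^'d^'d" where
  "mat_sqrt A = (THE R. pd_mat R \<and> R ** R = A)"

definition mat_inv_sqrt :: "real^'d^'d \<Rightarrow> real^'d^'d" where
  "mat_inv_sqrt A = matrix_inv (mat_sqrt A)"

definition frob_inner :: "real^'d^'d \<Rightarrow> real^'d^'d \<Rightarrow> real" where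
  "frob_inner A B = trace (transpose A ** B)"

definition sqnorm_mat :: "real^'d^'d \<Rightarrow> real^'d \<Rightarrow> real" where
  "sqnorm_mat A w = w \<bullet> (A *v w)"

definition risk :: "((real^'d) \<times> real) measure \<Rightarrow> real^'d \<Rightarrow> real" where
  "risk P w = (1/2) * (\<integral>z. (snd z - w \<bullet> fst z)^2 \<partial>P)"

text \<open>The problem class, as triples (P, Q, w*): w* is the common minimizer appearing in the risk.\<close>
definition problem_class ::
  "(real^'d) set \<Rightarrow> real^'d^'d \<Rightarrow> real^'d^'d \<Rightarrow> real \<Rightarrow>
   (((real^'d) \<times> real) measure \<times> ((real^'d) \<times> real) measure \<times> (real^'d)) set" where
  "problem_class W S T \<sigma> = {(P, Q, w). 
     prob_space P \<and> sets P = sets borel \<and>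
     prob_space Q \<and> sets Q = sets borel \<and>
     integrable P (\<lambda>z. (norm (fst z))^2 + (snd z)^2) \<and>
     integrable Q (\<lambda>z. (norm (fst z))^2 + (snd z)^2) \<and>
     (\<forall>i j. (\<integral>z. fst z $ i * fst z $ j \<partial>P) = S $ i $ j) \<and>
     (\<forall>i j. (\<integral>z. fst z $ i * fst z $ j \<partial>Q) = T $ i $ j) \<and>
     (\<forall>v. risk P w \<le> risk P v) \<and> (\<forall>v. risk Q w \<le> risk Q v) \<and>
     w \<in> W \<and>
     (\<forall>v. (\<integral>\<^sup>+z. ennreal ((snd z - fst z \<bullet> w)^2 * (v \<bullet> fst z)^2) \<partial>P)
            \<le> ennreal (\<sigma>^2 * (v \<bullet> (S *v v))))}"

text \<open>Randomized estimators: an auxiliary probability space \<open>Xi\<close> (law independent of (P,Q))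
  together with a jointly measurable map from the n samples and \<open>\<xi>\<close> to \<open>\<real>^d\<close>.\<close>
definition estimators :: "nat \<Rightarrow> ('r measure \<times> ((nat \<Rightarrow> (real^'d) \<times> real) \<times> 'r \<Rightarrow> real^'d)) set" where
  "estimators n = {(Xi, est). prob_space Xi \<and>
      est \<in> borel_measurable ((\<Pi>\<^sub>M i\<in>{..<n}. (borel :: ((real^'d) \<times> real) measure)) \<Otimes>\<^sub>M Xi)}"

definition expected_loss ::
  "nat \<Rightarrow> real^'d^'d \<Rightarrow> 'r measure \<Rightarrow> ((nat \<Rightarrow> (real^'d) \<times> real) \<times> 'r \<Rightarrow> real^'d)
   \<Rightarrow> ((real^'d) \<times> real) measure \<Rightarrow> real^'d \<Rightarrow> ennreal" where
  "expected_loss n T Xi est P w =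
     (\<integral>\<^sup>+\<omega>. ennreal (sqnorm_mat T (est \<omega> - w)) \<partial>((\<Pi>\<^sub>M i\<in>{..<n}. P) \<Otimes>\<^sub>M Xi))"

end

theory Submission
  imports Defs
begin

text \<open>The minimax risk dominates every Bayes risk, and the Bayes risk is bounded from below by the
  van Trees inequality. The source is the Gaussian linear model \<open>y = \<langle>w, x\<rangle> + N(0, \<sigma>\<^sup>2)\<close>, whose Fisher
  information about \<open>w\<close> is \<open>n S / \<sigma>\<^sup>2\<close>. The prior is put on \<open>w = M\<^sup>-\<^sup>1\<^sup>/\<^sup>2 V \<theta>\<close>, where the columns
  of \<open>V\<close> are orthogonal eigenvectors of \<open>F\<close> with \<open>V V\<^sup>T = \<pi>\<^sup>2 F\<close> and the coordinates of \<open>\<theta>\<close> are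
  independent with density \<open>cos\<^sup>2 (\<pi> t / 2)\<close> on \<open>[-1, 1]\<close>, which has Fisher information \<open>\<pi>\<^sup>2\<close>. Since
  \<open>\<pi>\<^sup>2 tr F \<le> 1\<close>, the image of the cube lies in \<open>W\<close>, and the information of the prior in the coordinates
  \<open>M\<^sup>1\<^sup>/\<^sup>2 w\<close> is exactly \<open>F\<^sup>-\<^sup>1\<close>.\<close>

section \<open>Symmetric matrices\<close>

text \<open>The constant 1 / pi^2 combines two facts. The square root of the density cos^2 (pi t /
  2) is the first Dirichlet eigenfunction of [-1, 1], with eigenvalue (pi / 2)^2, so four times
  this, pi^2, is the least Fisher information a density on that interval can have. A box with
  half-widths pi * sqrt (f i), where the f i are the eigenvalues of F, lies in the unit ball exactly
  when pi^2 tr F is at most 1; stretching by a half-width divides pi^2 by pi^2 * f i and leaves 1 /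
  f i. Two obstacles shape the rest. S and T may be singular, so they are never inverted: they enter
  through factors S = R^T R and T = Q^T Q, the covariates take finitely many values, and only the
  information pi^2 I + J is inverted, where J comes from the sample. The estimator is merely
  measurable, so nothing is differentiated in the data: integration by parts runs over the parameter
  for a fixed sample, where the estimate is a constant. The randomization has a law free of the
  parameter and is therefore absorbed into the dominating measure.\<close>

lemma symmetric_matrix_inner:
  fixes A :: "real^'n^'n"
  assumes "transpose A = A"
  shows "x \<bullet> (A *v y) = (A *v x) \<bullet> y"
  by (metis assms dot_lmul_matrix transpose_matrix_vector)

lemma inner_transpose_matrix:
  fixes A :: "real^'n^'m"
  shows "x \<bullet> (A *v y) = (transpose A *v x) \<bullet> y"
  by (simp add: dot_lmul_matrix)

text \<open>A maximiser of the Rayleigh quotient on the orthogonal complement of the eigenvectors found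
  so far is a further eigenvector.\<close>
lemma symmetric_orthonormal_eigenvectors:
  fixes A :: "real^'n^'n"
  assumes sym: "transpose A = A" and "k \<le> CARD('n)"
  shows "\<exists>E. finite E \<and> card E = k \<and> pairwise orthogonal E \<and>
    (\<forall>e\<in>E. norm e = 1 \<and> (\<exists>\<mu>. A *v e = \<mu> *\<^sub>R e))"
  using assms(2)
proof (induction k)
  case 0
  show ?case by (intro exI[of _ "{}"]) simp
next
  case (Suc k)
  then obtain E where E: "finite E" "card E = k" "pairwise orthogonal E"
    and eig: "\<And>e. e \<in> E \<Longrightarrow> norm e = 1 \<and> (\<exists>\<mu>. A *v e = \<mu> *\<^sub>R e)"
    by auto
  define V where "V = {x. \<forall>e\<in>E. e \<bullet> x = 0}"
  have "dim E < DIM(real^'n)"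
    using E dim_le_card'[of E] Suc.prems by simp
  then obtain z where z: "z \<noteq> 0" "\<And>y. y \<in> span E \<Longrightarrow> orthogonal z y"
    using orthogonal_to_subspace_exists[of E] by blast
  have zV: "z \<in> V"
    using z(2) by (auto simp: V_def orthogonal_def inner_commute span_base)
  have scaleV: "c *\<^sub>R x \<in> V" if "x \<in> V" for c x
    using that by (simp add: V_def)
  have addV: "x + y \<in> V" if "x \<in> V" "y \<in> V" for x y
    using that by (simp add: V_def inner_add_right)
  have AV: "A *v x \<in> V" if "x \<in> V" for x
    unfolding V_def
  proof safe
    fix e assume e: "e \<in> E"
    then obtain \<mu> where "A *v e = \<mu> *\<^sub>R e" using eig by blast
    then show "e \<bullet> (A *v x) = 0"
      using that e by (simp add: symmetric_matrix_inner[OF sym] V_def)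
  qed
  have "closed V"
    unfolding V_def Ball_def
    by (intro closed_Collect_all closed_Collect_imp closed_Collect_eq continuous_intros) simp
  then have comp: "compact (sphere 0 1 \<inter> V)"
    by (intro compact_Int_closed compact_sphere)
  have "(1 / norm z) *\<^sub>R z \<in> sphere 0 1 \<inter> V"
    using z(1) zV scaleV by simp
  then have ne: "sphere 0 1 \<inter> V \<noteq> {}" by blast
  have "continuous_on (sphere 0 1 \<inter> V) (\<lambda>x. x \<bullet> (A *v x))"
    by (intro continuous_intros linear_continuous_on matrix_vector_mul_bounded_linear)
  from continuous_attains_sup[OF comp ne this]
  obtain x where x: "norm x = 1" "x \<in> V"
    and max: "\<And>y. norm y = 1 \<Longrightarrow> y \<in> V \<Longrightarrow> y \<bullet> (A *v y) \<le> x \<bullet> (A *v x)"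
    by auto
  define \<mu> where "\<mu> = x \<bullet> (A *v x)"
  have max': "y \<bullet> (A *v y) \<le> \<mu> * (norm y)\<^sup>2" if "y \<in> V" for y
  proof (cases "y = 0")
    case False
    let ?y = "(1 / norm y) *\<^sub>R y"
    have "?y \<bullet> (A *v ?y) \<le> \<mu>"
      unfolding \<mu>_def using max[of ?y] scaleV[OF that] False by simp
    then show ?thesis
      using False by (simp add: matrix_vector_mult_scaleR field_simps power2_eq_square)
  qed simp
  define g where "g = A *v x - \<mu> *\<^sub>R x"
  have gV: "g \<in> V"
    using addV[OF AV[OF x(2)] scaleV[OF x(2), of "-\<mu>"]] by (simp add: g_def)
  \<comment> \<open>First-order optimality: the quotient stays below its maximum along the line
    through \<open>x\<close> in the direction of the residual \<open>g\<close>, and the linear term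
    there is \<open>2 * t * (g \<bullet> g)\<close>.\<close>
  have ineq: "2 * t * (g \<bullet> g) + t\<^sup>2 * (g \<bullet> (A *v g) - \<mu> * (norm g)\<^sup>2) \<le> 0" for t
  proof -
    have m: "(x + t *\<^sub>R g) \<bullet> (A *v (x + t *\<^sub>R g)) \<le> \<mu> * (norm (x + t *\<^sub>R g))\<^sup>2"
      by (intro max' addV x gV scaleV)
    have gA: "x \<bullet> (A *v g) = g \<bullet> (A *v x)"
      by (metis symmetric_matrix_inner[OF sym] inner_commute)
    have e1: "(x + t *\<^sub>R g) \<bullet> (A *v (x + t *\<^sub>R g)) =
        \<mu> + 2 * t * (g \<bullet> (A *v x)) + t\<^sup>2 * (g \<bullet> (A *v g))"
      by (simp add: matrix_vector_right_distrib matrix_vector_mult_scaleR inner_add_left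
        inner_add_right gA \<mu>_def[symmetric] algebra_simps power2_eq_square)
    have e2: "(norm (x + t *\<^sub>R g))\<^sup>2 = 1 + 2 * t * (g \<bullet> x) + t\<^sup>2 * (norm g)\<^sup>2"
      unfolding power2_norm_eq_inner using x(1) by (simp add: inner_add_left inner_add_right norm_eq_1
        inner_commute algebra_simps power2_eq_square)
    have e3: "g \<bullet> g = g \<bullet> (A *v x) - \<mu> * (g \<bullet> x)"
      by (simp add: g_def inner_diff_right)
    show ?thesis using m unfolding e1 e2 e3 by (simp add: algebra_simps)
  qed
  have "g \<bullet> g = 0"
  proof (rule ccontr)
    assume "g \<bullet> g \<noteq> 0"
    then have pos: "g \<bullet> g > 0" by simp
    define c where "c = \<bar>g \<bullet> (A *v g) - \<mu> * (norm g)\<^sup>2\<bar>"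
    \<comment> \<open>With this step size the quadratic term costs at most
      \<open>t * (g \<bullet> g)\<close>, half of the linear gain.\<close>
    define t where "t = (g \<bullet> g) / (c + 1)"
    have c: "c \<ge> 0" by (simp add: c_def)
    have t: "t > 0" using pos c by (simp add: t_def)
    have "t * c \<le> g \<bullet> g" using pos c by (simp add: t_def field_simps)
    then have "t * (t * c) \<le> t * (g \<bullet> g)" using t by simp
    moreover have "t\<^sup>2 * (g \<bullet> (A *v g) - \<mu> * (norm g)\<^sup>2) \<ge> - (t\<^sup>2 * c)"
      unfolding c_def by (metis abs_ge_minus_self mult_left_mono minus_le_iff mult_minus_right zero_le_power2)
    moreover have "t * (g \<bullet> g) > 0" using t pos by simp
    ultimately show False using ineq[of t] by (simp add: power2_eq_square algebra_simps)
  qed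
  then have "A *v x = \<mu> *\<^sub>R x" by (simp add: g_def)
  moreover have "x \<notin> E"
    using x by (auto simp: V_def norm_eq_1)
  moreover have "pairwise orthogonal (insert x E)"
    using E(3) x(2) by (auto simp: pairwise_insert orthogonal_def V_def inner_commute)
  ultimately show ?case
    using E eig x(1) by (intro exI[of _ "insert x E"]) auto
qed

section \<open>Spectral theorem for symmetric matrices\<close>

definition diag_matrix :: "('n \<Rightarrow> real) \<Rightarrow> real^'n^'n" where
  "diag_matrix f = (\<chi> i j. if i = j then f i else 0)"

lemma transpose_diag_matrix [simp]: "transpose (diag_matrix f) = diag_matrix f"
  by (auto simp: diag_matrix_def transpose_def vec_eq_iff)

lemma matrix_mult_diag_matrix: "(A ** diag_matrix f) $ i $ j = A $ i $ j * f j"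
proof -
  have "(A ** diag_matrix f) $ i $ j = (\<Sum>k\<in>UNIV. if k = j then A $ i $ k * f k else 0)"
    unfolding diag_matrix_def matrix_matrix_mult_def vec_lambda_beta by (intro sum.cong) auto
  then show ?thesis by simp
qed

lemma diag_matrix_mult: "diag_matrix f ** diag_matrix g = diag_matrix (\<lambda>i. f i * g i)"
  unfolding vec_eq_iff matrix_mult_diag_matrix by (auto simp: diag_matrix_def)

lemma diag_matrix_vector_mult: "(diag_matrix f *v x) $ i = f i * x $ i"
proof -
  have "(diag_matrix f *v x) $ i = (\<Sum>k\<in>UNIV. if k = i then f k * x $ k else 0)"
    unfolding diag_matrix_def matrix_vector_mult_def vec_lambda_beta by (intro sum.cong) auto
  then show ?thesis by simp
qed

theorem symmetric_matrix_diagonalization: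
  fixes A :: "real^'n^'n"
  assumes sym: "transpose A = A"
  obtains U f where "orthogonal_matrix U" "A = U ** diag_matrix f ** transpose U"
proof -
  obtain E where E: "finite E" "card E = CARD('n)" "pairwise orthogonal E"
    and eig: "\<And>e. e \<in> E \<Longrightarrow> norm e = 1 \<and> (\<exists>\<mu>. A *v e = \<mu> *\<^sub>R e)"
    using symmetric_orthonormal_eigenvectors[OF sym, of "CARD('n)"] by auto
  obtain v where v: "bij_betw v (UNIV :: 'n set) E"
    using finite_same_card_bij[of "UNIV :: 'n set" E] E by auto
  have vE: "v i \<in> E" for i using v by (auto simp: bij_betw_def)
  obtain f where f: "A *v v i = f i *\<^sub>R v i" for i
    using eig[OF vE] by metis
  have ortho: "v i \<bullet> v j = (if i = j then 1 else 0)" for i j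
  proof (cases "i = j")
    case False
    then have "v i \<noteq> v j" using v by (auto simp: bij_betw_def inj_on_def)
    then show ?thesis using E(3) vE False by (auto simp: pairwise_def orthogonal_def)
  qed (use eig[OF vE] in \<open>simp add: norm_eq_1\<close>)
  define U :: "real^'n^'n" where "U = (\<chi> i j. v j $ i)"
  have "transpose U ** U = mat 1"
    using ortho by (simp add: U_def transpose_def matrix_matrix_mult_def mat_def vec_eq_iff inner_vec_def)
  then have U: "orthogonal_matrix U" by (simp add: orthogonal_matrix)
  have "(A ** U) $ i $ j = (U ** diag_matrix f) $ i $ j" for i j
    using f[of j] unfolding matrix_mult_diag_matrix
    by (simp add: U_def matrix_matrix_mult_def matrix_vector_mult_def vec_eq_iff mult.commute)
  then have "A ** U = U ** diag_matrix f" by (simp add: vec_eq_iff)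
  then have "U ** diag_matrix f ** transpose U = A ** (U ** transpose U)"
    by (simp add: matrix_mul_assoc)
  also have "\<dots> = A" using U by (simp add: orthogonal_matrix_def)
  finally show ?thesis using that U by metis
qed

text \<open>Each entry of \<open>f\<close> is a value of the quadratic form at a nonzero vector;
  this is how definiteness of \<open>A\<close> becomes a sign condition on \<open>f\<close>.\<close>

lemma diagonalization_eigenvalue:
  assumes U: "orthogonal_matrix U" and A: "A = U ** diag_matrix f ** transpose U"
  shows "column k U \<bullet> (A *v column k U) = f k" and "column k U \<noteq> 0"
proof -
  have UU: "transpose U ** U = mat 1" using U by (simp add: orthogonal_matrix_def)
  have c: "column k U = U *v axis k 1" by (simp add: matrix_vector_mul_component column_def vec_eq_iff matrix_vector_mult_basis)
  have "A *v column k U = U *v (diag_matrix f *v ((transpose U ** U) *v axis k 1))"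
    by (simp add: A c matrix_vector_mul_assoc matrix_mul_assoc)
  then have "column k U \<bullet> (A *v column k U) = (transpose U ** U *v axis k 1) \<bullet> (diag_matrix f *v axis k 1)"
    by (simp only: UU c inner_transpose_matrix[of _ U] matrix_vector_mul_assoc[of "transpose U" U] matrix_vector_mul_lid)
  then show "column k U \<bullet> (A *v column k U) = f k"
    by (simp add: UU inner_axis' diag_matrix_vector_mult)
  have "transpose U *v column k U = axis k 1"
    using UU by (simp add: c matrix_vector_mul_assoc del: transpose_matrix_vector)
  then show "column k U \<noteq> 0" by (metis axis_eq_0_iff matrix_vector_mult_0_right zero_neq_one)
qed

lemma pd_imp_psd: "pd_mat A \<Longrightarrow> psd_mat A"
  unfolding pd_mat_def psd_mat_def by (metis inner_zero_left order.strict_implies_order order_refl)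

lemma psd_diagonalization:
  assumes "psd_mat A"
  obtains U f where "orthogonal_matrix U" "A = U ** diag_matrix f ** transpose U" "\<And>i. 0 \<le> f i"
proof -
  obtain U f where "orthogonal_matrix U" "A = U ** diag_matrix f ** transpose U"
    using symmetric_matrix_diagonalization assms unfolding psd_mat_def by metis
  then show ?thesis
    using that diagonalization_eigenvalue assms unfolding psd_mat_def by metis
qed

lemma pd_diagonalization:
  assumes "pd_mat A"
  obtains U f where "orthogonal_matrix U" "A = U ** diag_matrix f ** transpose U" "\<And>i. 0 < f i"
proof -
  obtain U f where "orthogonal_matrix U" "A = U ** diag_matrix f ** transpose U"
    using symmetric_matrix_diagonalization assms unfolding pd_mat_def by metis
  then show ?thesis
    using that diagonalization_eigenvalue assms unfolding pd_mat_def by metis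
qed

text \<open>Scale the eigenvectors by the square roots of the eigenvalues. For S the rows of the
  factor become design points; for T the factor turns the loss into a Euclidean norm. Singular
  matrices are covered.\<close>

lemma psd_factorization:
  assumes "psd_mat A"
  obtains R :: "real^'n^'n" where "A = transpose R ** R"
proof -
  obtain U f where U: "orthogonal_matrix U" "A = U ** diag_matrix f ** transpose U" "\<And>i. 0 \<le> f i"
    using psd_diagonalization[OF assms] by blast
  let ?R = "diag_matrix (\<lambda>i. sqrt (f i)) ** transpose U"
  have "transpose ?R ** ?R
    = U ** (diag_matrix (\<lambda>i. sqrt (f i)) ** diag_matrix (\<lambda>i. sqrt (f i))) ** transpose U"
    by (simp only: matrix_transpose_mul transpose_transpose transpose_diag_matrix matrix_mul_assoc)
  also have "\<dots> = A" using U(2,3) by (simp add: diag_matrix_mult)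
  finally show ?thesis using that by metis
qed

lemma pd_mat_invertible:
  assumes "pd_mat (A :: real^'n^'n)" shows "invertible A"
proof -
  have "x = 0" if "A *v x = 0" for x
    using assms that unfolding pd_mat_def by (metis inner_zero_right less_irrefl)
  then show ?thesis
    by (simp add: invertible_left_inverse matrix_left_invertible_ker)
qed

section \<open>Square roots and inverses of positive definite matrices\<close>

lemma pd_mat_sqrt_exists:
  assumes "pd_mat (A :: real^'n^'n)"
  shows "\<exists>R. pd_mat R \<and> R ** R = A"
proof -
  obtain U f where U: "orthogonal_matrix U" "A = U ** diag_matrix f ** transpose U" "\<And>i. 0 < f i"
    using pd_diagonalization[OF assms] by blast
  have UU: "transpose U ** U = mat 1" "U ** transpose U = mat 1"
    using U by (simp_all add: orthogonal_matrix_def)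
  let ?D = "diag_matrix (\<lambda>i. sqrt (f i))"
  let ?R = "U ** ?D ** transpose U"
  have "?R ** ?R = U ** ?D ** (transpose U ** U) ** ?D ** transpose U"
    by (simp only: matrix_mul_assoc)
  also have "\<dots> = U ** (?D ** ?D) ** transpose U"
    by (simp add: UU matrix_mul_assoc)
  also have "?D ** ?D = diag_matrix f"
    using U(3) by (simp add: diag_matrix_mult less_imp_le)
  finally have sq: "?R ** ?R = A" using U(2) by simp
  have "pd_mat ?R"
    unfolding pd_mat_def
  proof safe
    show "transpose ?R = ?R"
      by (simp add: matrix_transpose_mul matrix_mul_assoc)
    fix v :: "real^'n" assume "v \<noteq> 0"
    define u where "u = transpose U *v v"
    have "U *v u = v" unfolding u_def by (simp only: matrix_vector_mul_assoc UU matrix_vector_mul_lid)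
    with \<open>v \<noteq> 0\<close> have "u \<noteq> 0" by auto
    then obtain i where i: "u $ i \<noteq> 0" by (auto simp: vec_eq_iff)
    have "v \<bullet> (?R *v v) = v \<bullet> (U *v (?D *v u))"
      by (simp only: u_def matrix_vector_mul_assoc matrix_mul_assoc)
    also have "\<dots> = u \<bullet> (?D *v u)" unfolding u_def by (rule inner_transpose_matrix)
    also have "\<dots> = (\<Sum>i\<in>UNIV. sqrt (f i) * (u $ i)\<^sup>2)"
      by (simp add: inner_vec_def diag_matrix_vector_mult power2_eq_square mult_ac)
    also have "\<dots> > 0"
      using U(3) i by (intro sum_pos2[of _ i]) (auto simp: less_imp_le)
    finally show "0 < v \<bullet> (?R *v v)" .
  qed
  with sq show ?thesis by blast
qed

text \<open>Exhibits the trace as a sum of values of the quadratic form of \<open>A\<close>, so a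
  vanishing trace forces every column of \<open>D\<close> to vanish when \<open>A\<close> is
  positive definite.\<close>

lemma trace_congruence:
  fixes A D :: "real^'n^'n"
  shows "trace (transpose D ** A ** D) = (\<Sum>i\<in>UNIV. column i D \<bullet> (A *v column i D))"
proof -
  have "trace (transpose D ** A ** D) = trace (transpose D ** (A ** D))"
    by (simp add: matrix_mul_assoc)
  also have "\<dots> = (\<Sum>i\<in>UNIV. column i D \<bullet> (A *v column i D))"
    unfolding trace_def
  proof (rule sum.cong[OF refl])
    fix i
    show "(transpose D ** (A ** D)) $ i $ i = column i D \<bullet> (A *v column i D)"
      by (simp add: matrix_matrix_mult_def transpose_def inner_vec_def column_def matrix_vector_mult_def)
  qed
  finally show ?thesis .
qed

lemma matrix_diff_ldistrib: "A ** (B - C) = A ** B - A ** (C :: real^'n^'m)"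
  by (simp add: vec_eq_iff matrix_matrix_mult_def right_diff_distrib sum_subtractf)

lemma matrix_diff_rdistrib: "(A - B) ** C = A ** C - B ** (C :: real^'n^'m)"
  by (simp add: vec_eq_iff matrix_matrix_mult_def left_diff_distrib sum_subtractf)

lemma matrix_add_rdistrib: "(A + B) ** C = A ** C + B ** (C :: real^'n^'m)"
  by (simp add: vec_eq_iff matrix_matrix_mult_def distrib_right sum.distrib)

lemma matrix_mult_scaleR_left: "(c *\<^sub>R A) ** B = c *\<^sub>R (A ** (B :: real^'n^'m))"
  by (simp add: vec_eq_iff matrix_matrix_mult_def sum_distrib_left mult.assoc)

lemma matrix_mult_scaleR_right: "A ** (c *\<^sub>R B) = c *\<^sub>R (A ** (B :: real^'n^'m))"
  by (simp add: vec_eq_iff matrix_matrix_mult_def sum_distrib_left mult_ac)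

text \<open>For two square roots with difference \<open>D\<close> one has \<open>R D + D Q = 0\<close>; multiplying by \<open>D\<close>
  and taking traces gives \<open>tr (D R D) + tr (D Q D) = 0\<close> with both terms nonnegative.\<close>
lemma pd_mat_sqrt_unique:
  fixes R Q :: "real^'n^'n"
  assumes R: "pd_mat R" and Q: "pd_mat Q" and eq: "R ** R = Q ** Q"
  shows "R = Q"
proof -
  define D where "D = R - Q"
  have symD: "transpose D = D"
    using R Q by (simp add: pd_mat_def D_def transpose_def vec_eq_iff)
  have "R ** D + D ** Q = 0"
    using eq by (simp add: D_def matrix_diff_ldistrib matrix_diff_rdistrib)
  then have "D ** (R ** D + D ** Q) = 0" by simp
  then have "trace (D ** R ** D) + trace (D ** (D ** Q)) = 0"
    by (metis matrix_add_ldistrib matrix_mul_assoc trace_add trace_0 mat_0)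
  moreover have "trace (D ** (D ** Q)) = trace (D ** Q ** D)"
    by (metis trace_mul_sym matrix_mul_assoc)
  ultimately have "trace (transpose D ** R ** D) + trace (transpose D ** Q ** D) = 0"
    by (simp add: symD)
  then have s: "(\<Sum>i\<in>UNIV. column i D \<bullet> (R *v column i D)) + (\<Sum>i\<in>UNIV. column i D \<bullet> (Q *v column i D)) = 0"
    by (simp add: trace_congruence)
  have nn: "0 \<le> column i D \<bullet> (R *v column i D)" "0 \<le> column i D \<bullet> (Q *v column i D)" for i
    using R Q pd_imp_psd by (auto simp: psd_mat_def)
  have "(\<Sum>i\<in>UNIV. column i D \<bullet> (R *v column i D)) = 0"
    using s nn by (simp add: add_nonneg_eq_0_iff sum_nonneg)
  then have "column i D \<bullet> (R *v column i D) = 0" for i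
    using nn by (simp add: sum_nonneg_eq_0_iff)
  then have "column i D = 0" for i
    using R unfolding pd_mat_def by (metis less_irrefl)
  then have "D = 0" by (simp add: column_def vec_eq_iff)
  then show ?thesis by (simp add: D_def)
qed

text \<open>\<open>mat_sqrt\<close> is a definite description, so existence and uniqueness must both
  be available before it has any property at all.\<close>

lemma mat_sqrt_pd:
  assumes "pd_mat (A :: real^'n^'n)"
  shows "pd_mat (mat_sqrt A)" "mat_sqrt A ** mat_sqrt A = A"
proof -
  have "\<exists>!R. pd_mat R \<and> R ** R = A"
    using pd_mat_sqrt_exists[OF assms] pd_mat_sqrt_unique by metis
  from theI'[OF this] show "pd_mat (mat_sqrt A)" "mat_sqrt A ** mat_sqrt A = A"
    by (simp_all add: mat_sqrt_def)
qed

lemma matrix_inv_unique: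
  fixes A B :: "real^'n^'n"
  assumes "A ** B = mat 1"
  shows "matrix_inv A = B"
proof -
  have BA: "B ** A = mat 1" using assms matrix_left_right_inverse by blast
  have "matrix_inv A ** A = mat 1"
    unfolding matrix_inv_def using someI[of "\<lambda>A'. A ** A' = mat 1 \<and> A' ** A = mat 1" B] assms BA by auto
  then show ?thesis using assms by (metis matrix_mul_assoc matrix_mul_lid matrix_mul_rid)
qed

lemma matrix_inv_left_right:
  fixes A :: "real^'n^'n"
  assumes "invertible A"
  shows "A ** matrix_inv A = mat 1" "matrix_inv A ** A = mat 1"
  using assms matrix_inv_unique unfolding invertible_def by metis+

lemma transpose_matrix_inv:
  fixes A :: "real^'n^'n"
  assumes "invertible A" "transpose A = A"
  shows "transpose (matrix_inv A) = matrix_inv A"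
proof -
  have "transpose (matrix_inv A ** A) = mat 1" using matrix_inv_left_right[OF assms(1)] by simp
  then have "A ** transpose (matrix_inv A) = mat 1" using assms(2) by (simp add: matrix_transpose_mul)
  from matrix_inv_unique[OF this] show ?thesis by simp
qed

lemma mat_inv_sqrt_pd:
  fixes M :: "real^'n^'n"
  assumes "pd_mat M"
  shows "transpose (mat_inv_sqrt M) = mat_inv_sqrt M"
    and "mat_inv_sqrt M ** M ** mat_inv_sqrt M = mat 1"
proof -
  let ?R = "mat_sqrt M"
  have R: "pd_mat ?R" "?R ** ?R = M" using mat_sqrt_pd[OF assms] by auto
  have inv: "invertible ?R" using R(1) by (rule pd_mat_invertible)
  show "transpose (mat_inv_sqrt M) = mat_inv_sqrt M"
    unfolding mat_inv_sqrt_def using R(1) by (intro transpose_matrix_inv inv) (simp add: pd_mat_def)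
  have "mat_inv_sqrt M ** (?R ** ?R) ** mat_inv_sqrt M = (matrix_inv ?R ** ?R) ** (?R ** matrix_inv ?R)"
    unfolding mat_inv_sqrt_def by (simp only: matrix_mul_assoc)
  then show "mat_inv_sqrt M ** M ** mat_inv_sqrt M = mat 1"
    by (simp add: R(2) matrix_inv_left_right[OF inv])
qed

text \<open>The columns of \<open>V\<close> are eigenvectors of \<open>F\<close> scaled to the semi-axes of a box inscribed in the unit ball.\<close>
lemma pd_box_factor:
  fixes F :: "real^'n^'n"
  assumes F: "pd_mat F" and tr: "trace F \<le> 1 / pi\<^sup>2"
  obtains V :: "real^'n^'n" where "V ** transpose V = pi\<^sup>2 *\<^sub>R F"
    "\<forall>\<theta>. (\<forall>j. \<bar>\<theta> $ j\<bar> \<le> 1) \<longrightarrow> (V *v \<theta>) \<bullet> (V *v \<theta>) \<le> 1"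
proof -
  obtain U f where U: "orthogonal_matrix U" "F = U ** diag_matrix f ** transpose U" "\<And>i. 0 < f i"
    using pd_diagonalization[OF F] by blast
  have UU: "transpose U ** U = mat 1" "U ** transpose U = mat 1"
    using U by (simp_all add: orthogonal_matrix_def)
  \<comment> \<open>The squared half-widths are \<open>pi\<^sup>2 * f i\<close>; their sum, the
    squared distance of a corner from the origin, is pi^2 tr F.\<close>
  let ?D = "diag_matrix (\<lambda>i. pi * sqrt (f i))"
  have DD: "?D ** ?D = pi\<^sup>2 *\<^sub>R diag_matrix f"
    unfolding diag_matrix_mult using U(3)
    by (auto simp: diag_matrix_def vec_eq_iff power2_eq_square less_imp_le)
  show ?thesis
  proof (rule that[of "U ** ?D"])
    have "U ** ?D ** transpose (U ** ?D) = U ** (?D ** ?D) ** transpose U"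
      by (simp only: matrix_transpose_mul transpose_diag_matrix matrix_mul_assoc)
    also have "\<dots> = pi\<^sup>2 *\<^sub>R F"
      unfolding DD U(2) by (simp add: matrix_mult_scaleR_left matrix_mult_scaleR_right)
    finally show "U ** ?D ** transpose (U ** ?D) = pi\<^sup>2 *\<^sub>R F" .
    have "(U ** ?D *v \<theta>) \<bullet> (U ** ?D *v \<theta>) \<le> 1" if \<theta>: "\<forall>j. \<bar>\<theta> $ j\<bar> \<le> 1" for \<theta> :: "real^'n"
    proof -
      have "trace F = trace (transpose U ** (U ** diag_matrix f))"
        unfolding U(2) by (rule trace_mul_sym)
      also have "\<dots> = trace (transpose U ** U ** diag_matrix f)"
        by (simp only: matrix_mul_assoc)
      finally have "trace F = trace (transpose U ** U ** diag_matrix f)" .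
      then have trF: "trace F = (\<Sum>i\<in>UNIV. f i)"
        by (simp add: UU trace_def diag_matrix_def)
      have "(U ** ?D *v \<theta>) \<bullet> (U ** ?D *v \<theta>) = (U *v (?D *v \<theta>)) \<bullet> (U *v (?D *v \<theta>))"
        by (simp add: matrix_vector_mul_assoc)
      also have "\<dots> = (?D *v \<theta>) \<bullet> (?D *v \<theta>)"
        by (simp only: inner_transpose_matrix[of _ U] matrix_vector_mul_assoc[of "transpose U" U] UU matrix_vector_mul_lid)
      also have "\<dots> = (\<Sum>i\<in>UNIV. pi\<^sup>2 * (f i * (\<theta> $ i)\<^sup>2))"
        unfolding inner_vec_def diag_matrix_vector_mult inner_real_def
        by (intro sum.cong) (use U(3) in \<open>auto simp: power2_eq_square less_imp_le algebra_simps\<close>)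
      also have "\<dots> \<le> (\<Sum>i\<in>UNIV. pi\<^sup>2 * f i)"
      proof (intro sum_mono mult_left_mono)
        fix i
        have "(\<theta> $ i)\<^sup>2 \<le> 1" using \<theta>[rule_format, of i] by (simp add: abs_square_le_1)
        then show "f i * (\<theta> $ i)\<^sup>2 \<le> f i" using U(3)[of i] by (simp add: mult_left_le)
      qed simp
      also have "\<dots> = pi\<^sup>2 * trace F" by (simp add: trF sum_distrib_left)
      also have "\<dots> \<le> 1" using tr by (simp add: field_simps)
      finally show ?thesis .
    qed
    then show "\<forall>\<theta>. (\<forall>j. \<bar>\<theta> $ j\<bar> \<le> 1) \<longrightarrow> (U ** ?D *v \<theta>) \<bullet> (U ** ?D *v \<theta>) \<le> 1"
      by blast
  qed
qed

section \<open>The squared-cosine prior\<close>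

lemma PiM_component_integral:
  fixes f :: "'a \<Rightarrow> real"
  assumes P: "prob_space P" and i: "i \<in> I" and f: "has_bochner_integral P f x"
  shows "has_bochner_integral (\<Pi>\<^sub>M i\<in>I. P) (\<lambda>\<theta>. f (\<theta> i)) x"
proof -
  interpret prob_space P by fact
  interpret product_prob_space "\<lambda>_. P" I by standard
  have "has_bochner_integral (distr (\<Pi>\<^sub>M i\<in>I. P) P (\<lambda>\<theta>. \<theta> i)) f x"
    using f PiM_component[OF i] by simp
  moreover have "f \<in> borel_measurable P"
    using f by (auto simp: has_bochner_integral_iff)
  moreover have "(\<lambda>\<theta>. \<theta> i) \<in> measurable (\<Pi>\<^sub>M i\<in>I. P) P"
    using i by (rule measurable_component_singleton)
  ultimately show ?thesis
    by (simp only: has_bochner_integral_iff integrable_distr_eq integral_distr)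
qed

definition cos2_prior :: "real measure" where
  "cos2_prior = density lborel (\<lambda>t. ennreal (indicator {-1..1} t * (cos (pi * t / 2))\<^sup>2))"

text \<open>The logarithmic derivative of \<open>cos\<^sup>2 (\<pi> t / 2)\<close>; at \<open>t = \<plusminus>1\<close>, a null set, the division by zero
  yields \<open>0\<close>.\<close>
definition prior_score :: "real \<Rightarrow> real" where
  "prior_score t = - pi * (sin (pi * t / 2) / cos (pi * t / 2))"

lemma sets_cos2_prior [measurable_cong, simp]: "sets cos2_prior = sets borel"
  and space_cos2_prior [simp]: "space cos2_prior = UNIV"
  by (simp_all add: cos2_prior_def)

lemma prior_score_measurable [measurable]: "prior_score \<in> borel_measurable borel"
  unfolding prior_score_def[abs_def] by measurable

lemma cos_half_pi_pos: "-1 < t \<Longrightarrow> t < 1 \<Longrightarrow> 0 < cos (pi * t / 2)"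
  using mult_strict_left_mono[of "-1" t pi] by (intro cos_gt_zero_pi) auto

text \<open>\<open>g\<close> may blow up at the ends, as \<open>prior_score\<close> does, while its
  product with the density extends to a function \<open>f\<close> continuous on the whole line. The
  fundamental theorem of calculus is applied to \<open>f\<close>, and the two endpoints are a null
  set.\<close>

lemma has_bochner_integral_cos2_prior:
  assumes g: "g \<in> borel_measurable borel"
    and eq: "\<And>t. -1 < t \<Longrightarrow> t < 1 \<Longrightarrow> (cos (pi * t / 2))\<^sup>2 * g t = f t"
    and F: "\<And>t. (F has_real_derivative f t) (at t)"
    and f: "\<And>t. isCont f t"
  shows "has_bochner_integral cos2_prior g (F 1 - F (-1))"
  unfolding cos2_prior_def
proof (rule has_bochner_integral_density)
  have fb: "f \<in> borel_measurable borel"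
    using f by (intro borel_measurable_continuous_onI) (simp add: continuous_on_eq_continuous_at)
  have "has_bochner_integral lborel (\<lambda>t. f t * indicator {-1..1} t) (F 1 - F (-1))"
    using F f by (intro has_bochner_integral_FTC_Icc_real) auto
  moreover have "AE t in lborel. t \<noteq> 1" "AE t in lborel. t \<noteq> (-1::real)"
    by (rule AE_lborel_singleton)+
  then have "AE t in lborel. f t * indicator {-1..1} t
      = (indicator {-1..1} t * (cos (pi * t / 2))\<^sup>2) *\<^sub>R g t"
    by eventually_elim (auto split: split_indicator simp: eq)
  ultimately show "has_bochner_integral lborel
      (\<lambda>t. (indicator {-1..1} t * (cos (pi * t / 2))\<^sup>2) *\<^sub>R g t) (F 1 - F (-1))"
    using fb g by (subst (asm) has_bochner_integral_cong_AE) auto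
qed (use g in auto)

lemma prob_space_cos2_prior: "prob_space cos2_prior"
proof
  have "has_bochner_integral cos2_prior (\<lambda>_. 1)
      ((\<lambda>t. t / 2 + sin (pi * t) / (2 * pi)) 1 - (\<lambda>t. t / 2 + sin (pi * t) / (2 * pi)) (-1))"
  proof (rule has_bochner_integral_cos2_prior)
    show "((\<lambda>t. t / 2 + sin (pi * t) / (2 * pi)) has_real_derivative (1 + cos (pi * t)) / 2) (at t)" for t
      by (auto intro!: derivative_eq_intros simp: field_simps)
    show "(cos (pi * t / 2))\<^sup>2 * 1 = (1 + cos (pi * t)) / 2" for t
      using cos_double_cos[of "pi * t / 2"] by simp
  qed (auto intro!: continuous_intros)
  then have "has_bochner_integral cos2_prior (\<lambda>_. 1 :: real) 1" by simp
  then have "(\<integral>\<^sup>+t. ennreal 1 \<partial>cos2_prior) = ennreal 1"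
    by (subst nn_integral_eq_integral) (auto simp: has_bochner_integral_iff)
  then show "emeasure cos2_prior (space cos2_prior) = 1" by simp
qed

text \<open>The density cancels the poles of the squared tangent and leaves
  \<open>pi\<^sup>2 * (sin (pi * t / 2))\<^sup>2\<close>; the squared sine integrates to 1 over
  [-1, 1].\<close>

lemma prior_score_second_moment: "has_bochner_integral cos2_prior (\<lambda>t. (prior_score t)\<^sup>2) (pi\<^sup>2)"
proof -
  have "has_bochner_integral cos2_prior (\<lambda>t. (prior_score t)\<^sup>2)
      ((\<lambda>t. pi\<^sup>2 * (t / 2 - sin (pi * t) / (2 * pi))) 1 - (\<lambda>t. pi\<^sup>2 * (t / 2 - sin (pi * t) / (2 * pi))) (-1))"
  proof (rule has_bochner_integral_cos2_prior)
    show "((\<lambda>t. pi\<^sup>2 * (t / 2 - sin (pi * t) / (2 * pi))) has_real_derivative pi\<^sup>2 * ((1 - cos (pi * t)) / 2)) (at t)" for t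
      by (auto intro!: derivative_eq_intros simp: field_simps)
    show "(cos (pi * t / 2))\<^sup>2 * (prior_score t)\<^sup>2 = pi\<^sup>2 * ((1 - cos (pi * t)) / 2)" if "-1 < t" "t < 1" for t
    proof -
      have "(cos (pi * t / 2))\<^sup>2 * (prior_score t)\<^sup>2 = pi\<^sup>2 * (sin (pi * t / 2))\<^sup>2"
        using cos_half_pi_pos[OF that] by (simp add: prior_score_def power_mult_distrib power_divide)
      also have "(sin (pi * t / 2))\<^sup>2 = (1 - cos (pi * t)) / 2"
        using cos_double_sin[of "pi * t / 2"] by simp
      finally show ?thesis .
    qed
  qed (auto intro!: continuous_intros)
  then show ?thesis by simp
qed

text \<open>Times the density, the integrand is the derivative of
  \<open>(cos (pi * t / 2))\<^sup>2 * l t\<close>. The boundary terms vanish because the density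
  does at both ends, whatever values \<open>l\<close> takes there.\<close>

lemma cos2_prior_integration_by_parts:
  assumes l: "\<And>t. (l has_real_derivative l' t) (at t)" and l': "continuous_on UNIV l'"
  shows "(\<integral>t. l t * prior_score t + l' t \<partial>cos2_prior) = 0"
proof -
  have cl: "isCont l t" for t using l DERIV_isCont by blast
  have cl': "isCont l' t" for t using l' by (simp add: continuous_on_eq_continuous_at)
  have [measurable]: "l \<in> borel_measurable borel" "l' \<in> borel_measurable borel"
    using cl l' by (auto intro!: borel_measurable_continuous_onI simp: continuous_on_eq_continuous_at)
  let ?c = "\<lambda>t. cos (pi * t / 2)"
  have "has_bochner_integral cos2_prior (\<lambda>t. l t * prior_score t + l' t)
      ((\<lambda>t. (?c t)\<^sup>2 * l t) 1 - (\<lambda>t. (?c t)\<^sup>2 * l t) (-1))"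
  proof (rule has_bochner_integral_cos2_prior)
    show "((\<lambda>t. (?c t)\<^sup>2 * l t) has_real_derivative
        (?c t)\<^sup>2 * l' t - pi * sin (pi * t / 2) * ?c t * l t) (at t)" for t
      by (auto intro!: derivative_eq_intros l simp: field_simps)
    show "(?c t)\<^sup>2 * (l t * prior_score t + l' t) = (?c t)\<^sup>2 * l' t - pi * sin (pi * t / 2) * ?c t * l t"
      if "-1 < t" "t < 1" for t
      using cos_half_pi_pos[OF that] by (simp add: prior_score_def field_simps power2_eq_square)
  qed (auto intro!: continuous_intros cl cl')
  then show ?thesis by (simp add: has_bochner_integral_iff)
qed

section \<open>The product prior on the cube\<close>

abbreviation box_prior :: "('d::finite \<Rightarrow> real) measure" where
  "box_prior \<equiv> \<Pi>\<^sub>M j\<in>UNIV. cos2_prior"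

interpretation cos2_prior: prob_space cos2_prior
  by (rule prob_space_cos2_prior)

interpretation box_prior: product_prob_space "\<lambda>_::'d::finite. cos2_prior" UNIV
  by standard

lemma space_box_prior [simp]: "space box_prior = UNIV"
  by (simp add: space_PiM)

lemma prob_space_box_prior: "prob_space (box_prior :: ('d::finite \<Rightarrow> real) measure)"
  by (intro prob_space_PiM prob_space_cos2_prior)

lemma measure_box_prior [simp]:
  "emeasure (box_prior :: ('d::finite \<Rightarrow> real) measure) UNIV = 1"
  "measure (box_prior :: ('d::finite \<Rightarrow> real) measure) UNIV = 1"
  using prob_space.emeasure_space_1[OF prob_space_box_prior] prob_space.prob_space[OF prob_space_box_prior]
  by auto

lemma box_prior_supported: "AE \<theta> in (box_prior :: ('d::finite \<Rightarrow> real) measure). \<forall>j. \<bar>\<theta> j\<bar> \<le> 1"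
proof -
  have "AE t in cos2_prior. \<bar>t\<bar> \<le> 1"
    unfolding cos2_prior_def by (subst AE_density) (auto split: split_indicator)
  then have "AE \<theta> in (box_prior :: ('d \<Rightarrow> real) measure). \<bar>\<theta> j\<bar> \<le> 1" for j
    by (intro AE_PiM_component) (auto intro: prob_space_cos2_prior)
  then show ?thesis by (simp add: AE_finite_allI eventually_all_finite)
qed

text \<open>Fubini isolates coordinate \<open>j\<close>, and the one-dimensional identity makes the
  inner integral zero. Integrability is asked of the sum of the two terms, since this is what is
  known for almost every sample in the application.\<close>

lemma box_prior_integration_by_parts:
  fixes H H' :: "('d::finite \<Rightarrow> real) \<Rightarrow> real"
  assumes int: "integrable box_prior (\<lambda>\<theta>. H \<theta> * prior_score (\<theta> j) + H' \<theta>)"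
    and H: "\<And>\<theta> t. ((\<lambda>t. H (\<theta>(j := t))) has_real_derivative H' (\<theta>(j := t))) (at t)"
    and H': "\<And>\<theta>. continuous_on UNIV (\<lambda>t. H' (\<theta>(j := t)))"
  shows "(\<integral>\<theta>. H \<theta> * prior_score (\<theta> j) + H' \<theta> \<partial>box_prior) = 0"
proof -
  have U: "(UNIV :: 'd set) = insert j (UNIV - {j})" by auto
  have "(\<integral>\<theta>. H \<theta> * prior_score (\<theta> j) + H' \<theta> \<partial>(\<Pi>\<^sub>M j\<in>insert j (UNIV - {j}). cos2_prior))
    = (\<integral>\<theta>. (\<integral>t. H (\<theta>(j := t)) * prior_score ((\<theta>(j := t)) j) + H' (\<theta>(j := t)) \<partial>cos2_prior)
         \<partial>(\<Pi>\<^sub>M j\<in>UNIV - {j}. cos2_prior))"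
    using int U by (intro box_prior.product_integral_insert) auto
  also have "\<dots> = 0"
    using cos2_prior_integration_by_parts[OF H H'] by simp
  finally show ?thesis using U by simp
qed

lemma integrable_weighted_mult:
  fixes f g w :: "'a \<Rightarrow> real"
  assumes [measurable]: "f \<in> borel_measurable M" "g \<in> borel_measurable M" "w \<in> borel_measurable M"
    and w: "\<And>x. 0 \<le> w x"
    and "integrable M (\<lambda>x. w x * (f x)\<^sup>2)" "integrable M (\<lambda>x. w x * (g x)\<^sup>2)"
  shows "integrable M (\<lambda>x. w x * (f x * g x))"
proof (rule Bochner_Integration.integrable_bound)
  show "integrable M (\<lambda>x. w x * (f x)\<^sup>2 + w x * (g x)\<^sup>2)"
    using assms by simp
  have "\<bar>a * b\<bar> \<le> a\<^sup>2 + b\<^sup>2" for a b :: real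
  proof -
    have "0 \<le> (\<bar>a\<bar> - \<bar>b\<bar>)\<^sup>2" "0 \<le> a\<^sup>2" "0 \<le> b\<^sup>2" by simp_all
    moreover have "(\<bar>a\<bar> - \<bar>b\<bar>)\<^sup>2 = a\<^sup>2 + b\<^sup>2 - 2 * \<bar>a * b\<bar>"
      by (simp add: power2_diff abs_mult)
    ultimately show ?thesis by linarith
  qed
  then have "\<bar>w x * (f x * g x)\<bar> \<le> w x * ((f x)\<^sup>2 + (g x)\<^sup>2)" for x
    using w[of x] by (simp add: abs_mult[of "w x"] mult_left_mono)
  then show "AE x in M. norm (w x * (f x * g x)) \<le> norm (w x * (f x)\<^sup>2 + w x * (g x)\<^sup>2)"
    using w by (simp add: distrib_left[symmetric])
qed simp

lemma prior_score_moments: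
  fixes i j :: "'d::finite"
  shows "has_bochner_integral box_prior (\<lambda>\<theta>. prior_score (\<theta> i) * prior_score (\<theta> j)) (if i = j then pi\<^sup>2 else 0)"
proof -
  have sq: "has_bochner_integral box_prior (\<lambda>\<theta>::'d \<Rightarrow> real. (prior_score (\<theta> k))\<^sup>2) (pi\<^sup>2)" for k
    by (intro PiM_component_integral prob_space_cos2_prior prior_score_second_moment) simp
  show ?thesis
  proof (cases "i = j")
    case True
    then show ?thesis using sq[of j] by (simp add: power2_eq_square)
  next
    case False
    have int: "integrable box_prior (\<lambda>\<theta>. prior_score (\<theta> i) * prior_score (\<theta> j))"
      using integrable_weighted_mult[where w = "\<lambda>_. 1" and M = box_prior and
          f = "\<lambda>\<theta>. prior_score (\<theta> i)" and g = "\<lambda>\<theta>. prior_score (\<theta> j)"] sq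
      by (simp add: has_bochner_integral_iff)
    \<comment> \<open>The score of coordinate \<open>i\<close> is constant along coordinate
      \<open>j\<close>, so integration by parts along \<open>j\<close> applies with derivative
      0.\<close>
    then have "(\<integral>\<theta>. prior_score (\<theta> i) * prior_score (\<theta> j) + 0 \<partial>box_prior) = 0"
      using False by (intro box_prior_integration_by_parts[where H' = "\<lambda>_. 0"]) auto
    with int False show ?thesis by (simp add: has_bochner_integral_iff)
  qed
qed

section \<open>The van Trees inequality\<close>

text \<open>A dominated model: \<open>N\<close> is the base measure, \<open>L\<close> the density,
  \<open>\<psi> j\<close> the score of coordinate \<open>j\<close>, and \<open>J\<close> the
  information matrix, here the same at every parameter. The score is introduced through the
  derivative \<open>L * \<psi>\<close>, avoiding logarithms of \<open>L\<close>. Derivatives are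
  taken one coordinate at a time because the integration by parts is.\<close>

locale likelihood_model = sigma_finite_measure N
  for N :: "'w measure" +
  fixes L :: "('d::finite \<Rightarrow> real) \<Rightarrow> 'w \<Rightarrow> real"
    and \<psi> :: "'d \<Rightarrow> ('d \<Rightarrow> real) \<Rightarrow> 'w \<Rightarrow> real"
    and J :: "real^'d^'d"
  assumes L_measurable: "(\<lambda>p. L (fst p) (snd p)) \<in> borel_measurable (box_prior \<Otimes>\<^sub>M N)"
    and \<psi>_measurable: "\<And>j. (\<lambda>p. \<psi> j (fst p) (snd p)) \<in> borel_measurable (box_prior \<Otimes>\<^sub>M N)"
    and L_nonneg: "\<And>\<theta> \<omega>. 0 \<le> L \<theta> \<omega>"
    and L_deriv: "\<And>\<theta> j t \<omega>. ((\<lambda>t. L (\<theta>(j := t)) \<omega>) has_real_derivative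
        L (\<theta>(j := t)) \<omega> * \<psi> j (\<theta>(j := t)) \<omega>) (at t)"
    and \<psi>_cont: "\<And>\<theta> j \<omega>. continuous_on UNIV (\<lambda>t. \<psi> j (\<theta>(j := t)) \<omega>)"
    and L_total: "\<And>\<theta>. has_bochner_integral N (L \<theta>) 1"
    and score_mean: "\<And>\<theta> j. has_bochner_integral N (\<lambda>\<omega>. L \<theta> \<omega> * \<psi> j \<theta> \<omega>) 0"
    and information: "\<And>\<theta> i j. has_bochner_integral N (\<lambda>\<omega>. L \<theta> \<omega> * (\<psi> i \<theta> \<omega> * \<psi> j \<theta> \<omega>)) (J $ i $ j)"
begin

lemma sigma_finite_N: "sigma_finite_measure N"
  by (rule sigma_finite_measure_axioms)

sublocale pair_sigma_finite box_prior N
  by standard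

lemmas [measurable] = L_measurable \<psi>_measurable

abbreviation lik :: "('d \<Rightarrow> real) \<times> 'w \<Rightarrow> real" where "lik p \<equiv> L (fst p) (snd p)"
abbreviation ps :: "'d \<Rightarrow> ('d \<Rightarrow> real) \<times> 'w \<Rightarrow> real" where "ps j p \<equiv> prior_score (fst p j)"
abbreviation ls :: "'d \<Rightarrow> ('d \<Rightarrow> real) \<times> 'w \<Rightarrow> real" where "ls j p \<equiv> \<psi> j (fst p) (snd p)"

lemma component_measurable [measurable]: "(\<lambda>p. fst p j) \<in> borel_measurable (box_prior \<Otimes>\<^sub>M N)"
proof -
  have "(\<lambda>p. fst p j) \<in> measurable (box_prior \<Otimes>\<^sub>M N) cos2_prior"
    by (rule measurable_compose[OF measurable_fst measurable_component_singleton]) simp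
  then show ?thesis by (simp cong: measurable_cong_sets)
qed

lemma ps_measurable [measurable]: "ps j \<in> borel_measurable (box_prior \<Otimes>\<^sub>M N)"
  by measurable

lemma lik_integral: "has_bochner_integral (box_prior \<Otimes>\<^sub>M N) lik 1"
proof -
  have int: "integrable (box_prior \<Otimes>\<^sub>M N) lik"
    using L_total L_nonneg
    by (intro Fubini_integrable) (auto simp: has_bochner_integral_iff)
  show ?thesis
    using integral_fst'[OF int] int L_total
    by (auto simp: has_bochner_integral_iff)
qed

lemma lik_ls_ls: "has_bochner_integral (box_prior \<Otimes>\<^sub>M N) (\<lambda>p. lik p * (ls i p * ls j p)) (J $ i $ j)"
proof -
  have sq: "integrable (box_prior \<Otimes>\<^sub>M N) (\<lambda>p. lik p * (ls j p)\<^sup>2)" for j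
    using information[of _ j j] L_nonneg
    by (intro Fubini_integrable) (auto simp: has_bochner_integral_iff power2_eq_square abs_mult)
  have int: "integrable (box_prior \<Otimes>\<^sub>M N) (\<lambda>p. lik p * (ls i p * ls j p))"
    by (intro integrable_weighted_mult sq L_nonneg) measurable
  show ?thesis
    using integral_fst'[OF int] int information
    by (auto simp: has_bochner_integral_iff)
qed

lemma lik_ps_ps:
  "has_bochner_integral (box_prior \<Otimes>\<^sub>M N) (\<lambda>p. lik p * (ps i p * ps j p)) (if i = j then pi\<^sup>2 else 0)"
proof -
  have sq: "integrable (box_prior \<Otimes>\<^sub>M N) (\<lambda>p. lik p * (ps j p)\<^sup>2)" for j
    using prior_score_moments[of j j] L_total L_nonneg
    by (intro Fubini_integrable) (auto simp: has_bochner_integral_iff power2_eq_square abs_mult)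
  have int: "integrable (box_prior \<Otimes>\<^sub>M N) (\<lambda>p. lik p * (ps i p * ps j p))"
    by (intro integrable_weighted_mult sq L_nonneg) measurable
  show ?thesis
    using integral_fst'[OF int] int L_total prior_score_moments[of i j]
    by (auto simp: has_bochner_integral_iff)
qed

text \<open>For a fixed parameter the prior score is a constant factor, and the likelihood score has
  mean zero.\<close>

lemma lik_ps_ls: "has_bochner_integral (box_prior \<Otimes>\<^sub>M N) (\<lambda>p. lik p * (ps i p * ls j p)) 0"
proof -
  have int: "integrable (box_prior \<Otimes>\<^sub>M N) (\<lambda>p. lik p * (ps i p * ls j p))"
    using lik_ps_ps[of i i] lik_ls_ls[of j j]
    by (intro integrable_weighted_mult L_nonneg)
      (auto simp: has_bochner_integral_iff power2_eq_square)
  have "(\<integral>\<omega>. L \<theta> \<omega> * (prior_score (\<theta> i) * \<psi> j \<theta> \<omega>) \<partial>N) = 0" for \<theta>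
  proof -
    have "(\<integral>\<omega>. L \<theta> \<omega> * (prior_score (\<theta> i) * \<psi> j \<theta> \<omega>) \<partial>N)
        = (\<integral>\<omega>. prior_score (\<theta> i) * (L \<theta> \<omega> * \<psi> j \<theta> \<omega>) \<partial>N)"
      by (intro Bochner_Integration.integral_cong) auto
    then show ?thesis using score_mean[of \<theta> j] by (simp add: has_bochner_integral_iff)
  qed
  then show ?thesis
    using integral_fst'[OF int] int by (auto simp: has_bochner_integral_iff)
qed

text \<open>The score of the joint density is the sum of the prior score and the likelihood score;
  as these are uncorrelated, their information matrices add.\<close>

lemma joint_score_information:
  "has_bochner_integral (box_prior \<Otimes>\<^sub>M N) (\<lambda>p. lik p * ((ps i p + ls i p) * (ps j p + ls j p)))
    ((pi\<^sup>2 *\<^sub>R mat 1 + J) $ i $ j)"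
proof -
  have "has_bochner_integral (box_prior \<Otimes>\<^sub>M N)
      (\<lambda>p. (lik p * (ps i p * ps j p) + lik p * (ls i p * ls j p))
         + (lik p * (ps i p * ls j p) + lik p * (ps j p * ls i p)))
      (((if i = j then pi\<^sup>2 else 0) + J $ i $ j) + (0 + 0))"
    by (intro has_bochner_integral_add lik_ps_ps lik_ls_ls lik_ps_ls)
  moreover have "(lik p * (ps i p * ps j p) + lik p * (ls i p * ls j p))
        + (lik p * (ps i p * ls j p) + lik p * (ps j p * ls i p))
      = lik p * ((ps i p + ls i p) * (ps j p + ls j p))" for p
    by (simp add: algebra_simps)
  ultimately show ?thesis
    by (simp add: mat_def split: if_splits)
qed

text \<open>With \<open>b = \<rho> - C \<theta>\<close> and \<open>s\<close> the joint score, integration by parts gives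
  \<open>E (b s\<^sup>T) = C\<close>, and \<open>E |b - D s|\<^sup>2 \<ge> 0\<close> is the claim.\<close>
theorem van_trees:
  fixes \<rho> :: "'w \<Rightarrow> real^'m" and C D :: "real^'d^'m"
  assumes \<rho>[measurable]: "\<rho> \<in> borel_measurable N"
    and D: "D ** (pi\<^sup>2 *\<^sub>R mat 1 + J) = C"
  shows "ennreal (\<Sum>i\<in>UNIV. \<Sum>j\<in>UNIV. C $ i $ j * D $ i $ j)
    \<le> (\<integral>\<^sup>+\<theta>. (\<integral>\<^sup>+\<omega>. ennreal (L \<theta> \<omega> * (norm (\<rho> \<omega> - C *v (\<chi> j. \<theta> j)))\<^sup>2) \<partial>N) \<partial>box_prior)"
proof -
  let ?M = "box_prior \<Otimes>\<^sub>M N"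
  define b where "b i p = \<rho> (snd p) $ i - (\<Sum>k\<in>UNIV. C $ i $ k * fst p k)" for i and p :: "('d \<Rightarrow> real) \<times> 'w"
  define s where "s j p = ps j p + ls j p" for j p
  have [measurable]: "(\<lambda>p. \<rho> (snd p) $ i) \<in> borel_measurable ?M" for i
    by (rule measurable_compose[OF measurable_compose[OF measurable_snd \<rho>]])
      (intro borel_measurable_continuous_onI continuous_intros)
  have [measurable]: "b i \<in> borel_measurable ?M" "s j \<in> borel_measurable ?M" for i j
    unfolding b_def[abs_def] s_def[abs_def] by measurable
  have norm_b: "(norm (\<rho> \<omega> - C *v (\<chi> j. \<theta> j)))\<^sup>2 = (\<Sum>i\<in>UNIV. (b i (\<theta>, \<omega>))\<^sup>2)" for \<theta> \<omega>
    unfolding power2_norm_eq_inner inner_vec_def b_def by (simp add: matrix_vector_mult_def power2_eq_square)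
  have "(\<lambda>p. ennreal (lik p * (\<Sum>i\<in>UNIV. (b i p)\<^sup>2))) \<in> borel_measurable ?M"
    by measurable
  note fubini = sigma_finite_measure.nn_integral_fst[OF sigma_finite_N this]
  have "(\<integral>\<^sup>+\<theta>. (\<integral>\<^sup>+\<omega>. ennreal (L \<theta> \<omega> * (norm (\<rho> \<omega> - C *v (\<chi> j. \<theta> j)))\<^sup>2) \<partial>N) \<partial>box_prior)
    = (\<integral>\<^sup>+p. ennreal (lik p * (\<Sum>i\<in>UNIV. (b i p)\<^sup>2)) \<partial>?M)"
    unfolding norm_b using fubini by simp
  also have "ennreal (\<Sum>i\<in>UNIV. \<Sum>j\<in>UNIV. C $ i $ j * D $ i $ j) \<le> \<dots>"
  proof (cases "(\<integral>\<^sup>+p. ennreal (lik p * (\<Sum>i\<in>UNIV. (b i p)\<^sup>2)) \<partial>?M) = \<infinity>")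
    \<comment> \<open>An infinite Bayes risk satisfies the bound trivially. A finite one makes each
      \<open>b i\<close> square integrable under the joint density, hence \<open>b i * s j\<close>
      integrable.\<close>
    case False
    have nn: "0 \<le> lik p * (\<Sum>i\<in>UNIV. (b i p)\<^sup>2)" for p
      by (intro mult_nonneg_nonneg L_nonneg sum_nonneg) simp
    have int: "integrable ?M (\<lambda>p. lik p * (\<Sum>i\<in>UNIV. (b i p)\<^sup>2))"
      using False nn by (intro integrableI_nonneg) (auto simp: top.not_eq_extremum)
    have int_b: "integrable ?M (\<lambda>p. lik p * (b i p)\<^sup>2)" for i
    proof (rule Bochner_Integration.integrable_bound[OF int])
      have "(b i p)\<^sup>2 \<le> (\<Sum>i\<in>UNIV. (b i p)\<^sup>2)" for p
        by (intro member_le_sum) auto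
      then show "AE p in ?M. norm (lik p * (b i p)\<^sup>2) \<le> norm (lik p * (\<Sum>i\<in>UNIV. (b i p)\<^sup>2))"
        using nn L_nonneg by (auto intro!: mult_left_mono simp: abs_mult sum_nonneg)
    qed simp
    have int_ss: "has_bochner_integral ?M (\<lambda>p. lik p * (s i p * s j p)) ((pi\<^sup>2 *\<^sub>R mat 1 + J) $ i $ j)" for i j
      unfolding s_def by (rule joint_score_information)
    have int_bs: "integrable ?M (\<lambda>p. lik p * (b i p * s j p))" for i j
      using int_b[of i] int_ss[of j j]
      by (intro integrable_weighted_mult L_nonneg) (auto simp: has_bochner_integral_iff power2_eq_square)
    have cross: "has_bochner_integral ?M (\<lambda>p. lik p * (b i p * s j p)) (C $ i $ j)" for i j
    proof -
      \<comment> \<open>Since the joint density has mass 1, the claim is that \<open>\<Phi>\<close>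
        integrates to 0. This is shown with the parameter as the inner variable, for almost every
        sample.\<close>
      define \<Phi> where "\<Phi> p = lik p * (b i p * s j p) - C $ i $ j * lik p" for p
      have \<Phi>: "integrable ?M \<Phi>"
        unfolding \<Phi>_def using int_bs lik_integral by (auto simp: has_bochner_integral_iff)
      then have \<Phi>c: "integrable ?M (case_prod (\<lambda>\<theta> \<omega>. \<Phi> (\<theta>, \<omega>)))" by simp
      have "AE \<omega> in N. integrable box_prior (\<lambda>\<theta>. \<Phi> (\<theta>, \<omega>))"
        using AE_integrable_snd[OF \<Phi>c] .
      then have "AE \<omega> in N. (\<integral>\<theta>. \<Phi> (\<theta>, \<omega>) \<partial>box_prior) = 0"
      proof eventually_elim
        case (elim \<omega>)
        \<comment> \<open>For a fixed sample \<open>\<rho>\<close> is constant, so \<open>H\<close>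
          is differentiable along coordinate \<open>j\<close> however irregular the estimator is.
          Differentiating \<open>b i\<close> contributes the term with
          \<open>C $ i $ j\<close>.\<close>
        define H where "H \<theta> = L \<theta> \<omega> * b i (\<theta>, \<omega>)" for \<theta>
        define H' where "H' \<theta> = L \<theta> \<omega> * \<psi> j \<theta> \<omega> * b i (\<theta>, \<omega>) - C $ i $ j * L \<theta> \<omega>" for \<theta>
        have \<Phi>_eq: "\<Phi> (\<theta>, \<omega>) = H \<theta> * prior_score (\<theta> j) + H' \<theta>" for \<theta>
          by (simp add: \<Phi>_def H_def H'_def s_def algebra_simps)
        have db: "((\<lambda>t. b i (\<theta>(j := t), \<omega>)) has_real_derivative - C $ i $ j) (at t)" for \<theta> t
        proof -
          have "((\<lambda>t. C $ i $ k * (\<theta>(j := t)) k) has_real_derivative (if k = j then C $ i $ k else 0)) (at t)" for k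
            by (cases "k = j") (auto intro!: derivative_eq_intros)
          then have "((\<lambda>t. \<rho> \<omega> $ i - (\<Sum>k\<in>UNIV. C $ i $ k * (\<theta>(j := t)) k)) has_real_derivative
              0 - (\<Sum>k\<in>UNIV. if k = j then C $ i $ k else 0)) (at t)"
            by (intro DERIV_diff DERIV_const DERIV_sum)
          then show ?thesis by (simp add: b_def)
        qed
        have dH: "((\<lambda>t. H (\<theta>(j := t))) has_real_derivative H' (\<theta>(j := t))) (at t)" for \<theta> t
          using DERIV_mult[OF L_deriv[of \<theta> j \<omega> t] db[of \<theta> t]]
          unfolding H_def H'_def by (simp add: algebra_simps)
        have contL: "continuous_on UNIV (\<lambda>t. L (\<theta>(j := t)) \<omega>)" for \<theta>
          using L_deriv DERIV_isCont by (fastforce simp: continuous_on_eq_continuous_at)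
        have contb: "continuous_on UNIV (\<lambda>t. b i (\<theta>(j := t), \<omega>))" for \<theta>
          using db DERIV_isCont by (fastforce simp: continuous_on_eq_continuous_at)
        have "continuous_on UNIV (\<lambda>t. H' (\<theta>(j := t)))" for \<theta>
          unfolding H'_def by (intro continuous_intros contL contb \<psi>_cont)
        then show ?case
          using box_prior_integration_by_parts[OF _ dH] elim unfolding \<Phi>_eq by blast
      qed
      then have "(\<integral>\<omega>. (\<integral>\<theta>. \<Phi> (\<theta>, \<omega>) \<partial>box_prior) \<partial>N) = (\<integral>\<omega>. 0 \<partial>N)"
        using borel_measurable_integrable[OF \<Phi>] by (intro integral_cong_AE) auto
      then have "integral\<^sup>L ?M \<Phi> = 0"
        using integral_snd[OF \<Phi>c] by simp
      moreover have "integral\<^sup>L ?M \<Phi> = (\<integral>p. lik p * (b i p * s j p) \<partial>?M) - C $ i $ j"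
        unfolding \<Phi>_def using int_bs lik_integral by (simp add: has_bochner_integral_iff)
      ultimately show ?thesis using int_bs by (simp add: has_bochner_integral_iff)
    qed
    \<comment> \<open>The sum over rows of 2 b (D s) - (D s)^2, weighted by the likelihood and
      expanded into the moments already computed.\<close>
    let ?lower = "\<lambda>p. (\<Sum>i\<in>UNIV. 2 * (\<Sum>j\<in>UNIV. D $ i $ j * (lik p * (b i p * s j p)))
        - (\<Sum>j\<in>UNIV. \<Sum>k\<in>UNIV. (D $ i $ j * D $ i $ k) * (lik p * (s j p * s k p))))"
    let ?K = "pi\<^sup>2 *\<^sub>R mat 1 + J"
    have lower: "has_bochner_integral ?M ?lower
        (\<Sum>i\<in>UNIV. 2 * (\<Sum>j\<in>UNIV. D $ i $ j * C $ i $ j)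
          - (\<Sum>j\<in>UNIV. \<Sum>k\<in>UNIV. (D $ i $ j * D $ i $ k) * ?K $ j $ k))"
      by (intro has_bochner_integral_sum has_bochner_integral_diff has_bochner_integral_mult_right cross int_ss)
    \<comment> \<open>Because \<open>D ** ?K = C\<close>, the quadratic term equals the inner
      product of the rows of \<open>D\<close> and \<open>C\<close>; the cross term contains it
      twice, so one copy survives.\<close>
    have "(\<Sum>j\<in>UNIV. \<Sum>k\<in>UNIV. (D $ i $ j * D $ i $ k) * ?K $ j $ k) = (\<Sum>k\<in>UNIV. D $ i $ k * C $ i $ k)" for i
      unfolding D[symmetric] matrix_matrix_mult_def vec_lambda_beta
      by (subst sum.swap) (simp only: sum_distrib_left mult_ac)
    then have val: "(\<Sum>i\<in>UNIV. 2 * (\<Sum>j\<in>UNIV. D $ i $ j * C $ i $ j)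
          - (\<Sum>j\<in>UNIV. \<Sum>k\<in>UNIV. (D $ i $ j * D $ i $ k) * ?K $ j $ k))
        = (\<Sum>i\<in>UNIV. \<Sum>j\<in>UNIV. C $ i $ j * D $ i $ j)"
      by (simp add: mult.commute)
    have le: "?lower p \<le> lik p * (\<Sum>i\<in>UNIV. (b i p)\<^sup>2)" for p
    proof -
      have "?lower p = (\<Sum>i\<in>UNIV. lik p * (2 * (b i p * (\<Sum>j\<in>UNIV. D $ i $ j * s j p)) - (\<Sum>j\<in>UNIV. D $ i $ j * s j p)\<^sup>2))"
        by (intro sum.cong) (simp_all add: power2_eq_square sum_product sum_distrib_left right_diff_distrib mult_ac)
      also have "\<dots> \<le> (\<Sum>i\<in>UNIV. lik p * (b i p)\<^sup>2)"
      proof (intro sum_mono mult_left_mono L_nonneg)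
        fix i
        have "0 \<le> (b i p - (\<Sum>j\<in>UNIV. D $ i $ j * s j p))\<^sup>2" by simp
        then show "2 * (b i p * (\<Sum>j\<in>UNIV. D $ i $ j * s j p)) - (\<Sum>j\<in>UNIV. D $ i $ j * s j p)\<^sup>2 \<le> (b i p)\<^sup>2"
          by (simp add: power2_diff)
      qed
      finally show ?thesis by (simp add: sum_distrib_left)
    qed
    have "(\<Sum>i\<in>UNIV. \<Sum>j\<in>UNIV. C $ i $ j * D $ i $ j) = integral\<^sup>L ?M ?lower"
      using lower val by (simp add: has_bochner_integral_iff)
    also have "\<dots> \<le> (\<integral>p. lik p * (\<Sum>i\<in>UNIV. (b i p)\<^sup>2) \<partial>?M)"
      using lower int le by (intro integral_mono) (auto simp: has_bochner_integral_iff)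
    finally have "ennreal (\<Sum>i\<in>UNIV. \<Sum>j\<in>UNIV. C $ i $ j * D $ i $ j)
        \<le> ennreal (\<integral>p. lik p * (\<Sum>i\<in>UNIV. (b i p)\<^sup>2) \<partial>?M)"
      by (rule ennreal_leI)
    then show ?thesis using nn_integral_eq_integral[OF int] nn by simp
  qed simp
  finally show ?thesis .
qed

end

section \<open>The Gaussian linear model\<close>

text \<open>Uniform on the rows of \<open>R\<close> scaled by \<open>\<surd>d\<close>, so that the second moment matrix is \<open>R\<^sup>T R\<close>.\<close>
definition design_law :: "real^'d^'d \<Rightarrow> (real^'d) measure" where
  "design_law R = distr (measure_pmf (pmf_of_set UNIV)) borel (\<lambda>k. sqrt (real CARD('d)) *\<^sub>R row k R)"

text \<open>The dominating measure shared by all parameters. The law of the covariates does not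
  involve \<open>w\<close>, so the density of the model with respect to it is just the conditional
  normal density of the response.\<close>

definition design_base :: "real^'d^'d \<Rightarrow> ((real^'d) \<times> real) measure" where
  "design_base R = design_law R \<Otimes>\<^sub>M lborel"

definition gaussian_model :: "real^'d^'d \<Rightarrow> real \<Rightarrow> real^'d \<Rightarrow> ((real^'d) \<times> real) measure" where
  "gaussian_model R \<sigma> w = density (design_base R) (\<lambda>z. ennreal (normal_density (fst z \<bullet> w) \<sigma> (snd z)))"

lemma prob_space_design_law: "prob_space (design_law R)"
  unfolding design_law_def by (intro prob_space.prob_space_distr measure_pmf.prob_space_axioms) simp

lemma sets_design_law [measurable_cong, simp]: "sets (design_law R) = sets borel"
  and space_design_law [simp]: "space (design_law R) = UNIV"
  by (simp_all add: design_law_def)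

lemma sets_design_base [measurable_cong, simp]: "sets (design_base R) = sets borel"
  unfolding design_base_def borel_prod[symmetric] by (intro sets_pair_measure_cong) simp_all

lemma space_design_base [simp]: "space (design_base R) = UNIV"
  using sets_eq_imp_space_eq[OF sets_design_base[of R]] by simp

lemma sets_gaussian_model [measurable_cong, simp]: "sets (gaussian_model R \<sigma> w) = sets borel"
  and space_gaussian_model [simp]: "space (gaussian_model R \<sigma> w) = UNIV"
  by (simp_all add: gaussian_model_def)

lemma sigma_finite_design_base: "sigma_finite_measure (design_base R)"
proof -
  interpret prob_space "design_law R" by (rule prob_space_design_law)
  interpret pair_sigma_finite "design_law R" lborel by standard
  show ?thesis unfolding design_base_def by (rule sigma_finite_measure_axioms)
qed

lemma design_law_integral:
  fixes g :: "real^'d \<Rightarrow> real"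
  assumes [measurable]: "g \<in> borel_measurable borel"
  shows "has_bochner_integral (design_law R) g
    ((\<Sum>k\<in>UNIV. g (sqrt (real CARD('d)) *\<^sub>R row k R)) / real CARD('d))"
proof -
  have "integrable (design_law R) g"
    unfolding design_law_def by (subst integrable_distr_eq) (auto intro: integrable_measure_pmf_finite)
  moreover have "integral\<^sup>L (design_law R) g
      = (\<Sum>k\<in>UNIV. g (sqrt (real CARD('d)) *\<^sub>R row k R)) / real CARD('d)"
    unfolding design_law_def by (subst integral_distr) (auto simp: integral_pmf_of_set)
  ultimately show ?thesis by (simp add: has_bochner_integral_iff)
qed

lemma normal_density_mean_measurable [measurable]:
  assumes [measurable]: "f \<in> borel_measurable M" "g \<in> borel_measurable M"
  shows "(\<lambda>x. normal_density (f x) \<sigma> (g x)) \<in> borel_measurable M"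
  unfolding normal_density_def by measurable

lemma normal_quadratic_integral:
  assumes "0 < \<sigma>"
  shows "has_bochner_integral lborel
    (\<lambda>y. normal_density \<mu> \<sigma> y * (a + b * (y - \<mu>) + c * (y - \<mu>)\<^sup>2)) (a + \<sigma>\<^sup>2 * c)"
proof -
  have 0: "has_bochner_integral lborel (normal_density \<mu> \<sigma>) 1"
    using assms by (simp add: has_bochner_integral_iff)
  have 1: "has_bochner_integral lborel (\<lambda>y. normal_density \<mu> \<sigma> y * (y - \<mu>)) 0"
    using normal_moment_odd[OF assms, of \<mu> 0] by simp
  have 2: "has_bochner_integral lborel (\<lambda>y. normal_density \<mu> \<sigma> y * (y - \<mu>)\<^sup>2) (\<sigma>\<^sup>2)"
    using normal_moment_even[OF assms, of \<mu> 1] by simp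
  have "has_bochner_integral lborel (\<lambda>y. (a * normal_density \<mu> \<sigma> y
      + b * (normal_density \<mu> \<sigma> y * (y - \<mu>))) + c * (normal_density \<mu> \<sigma> y * (y - \<mu>)\<^sup>2)) ((a * 1 + b * 0) + c * \<sigma>\<^sup>2)"
    by (intro has_bochner_integral_add has_bochner_integral_mult_right 0 1 2)
  then show ?thesis by (simp add: algebra_simps)
qed

text \<open>All integrands needed for the model are, for fixed \<open>x\<close>, of degree at most
  two in the residual. Normal moments integrate out \<open>y\<close>, the odd term drops, and the
  design leaves a finite average.\<close>

lemma gaussian_model_integral:
  fixes a b c :: "real^'d \<Rightarrow> real"
  assumes \<sigma>: "0 < \<sigma>"
    and [measurable]: "a \<in> borel_measurable borel" "b \<in> borel_measurable borel" "c \<in> borel_measurable borel"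
    and h: "\<And>x y. h (x, y) = a x + b x * (y - x \<bullet> w) + c x * (y - x \<bullet> w)\<^sup>2"
  shows "has_bochner_integral (gaussian_model R \<sigma> w) h
    ((\<Sum>k\<in>UNIV. a (sqrt (real CARD('d)) *\<^sub>R row k R) + \<sigma>\<^sup>2 * c (sqrt (real CARD('d)) *\<^sub>R row k R)) / real CARD('d))"
proof -
  interpret X: prob_space "design_law R" by (rule prob_space_design_law)
  interpret pair_sigma_finite "design_law R" lborel by standard
  let ?f = "\<lambda>z. normal_density (fst z \<bullet> w) \<sigma> (snd z)"
  have h_eq: "h = (\<lambda>z. a (fst z) + b (fst z) * (snd z - fst z \<bullet> w) + c (fst z) * (snd z - fst z \<bullet> w)\<^sup>2)"
    using h by (auto simp: fun_eq_iff)
  have hb: "h \<in> borel_measurable (borel \<Otimes>\<^sub>M borel)"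
    unfolding h_eq by measurable
  then have [measurable]: "h \<in> borel_measurable (design_law R \<Otimes>\<^sub>M lborel)"
    by simp
  have fb: "?f \<in> borel_measurable (borel \<Otimes>\<^sub>M borel)" by measurable
  then have [measurable]: "?f \<in> borel_measurable (design_law R \<Otimes>\<^sub>M lborel)"
    by simp
  have inner: "has_bochner_integral lborel (\<lambda>y. ?f (x, y) * h (x, y)) (a x + \<sigma>\<^sup>2 * c x)" for x
    using normal_quadratic_integral[OF \<sigma>, of "x \<bullet> w" "a x" "b x" "c x"] by (simp add: h)
  have "(\<lambda>x. \<integral>y. norm (?f (x, y) * h (x, y)) \<partial>lborel) \<in> borel_measurable (design_law R)"
    by measurable
  then have "(\<lambda>x. \<integral>y. norm (?f (x, y) * h (x, y)) \<partial>lborel) \<in> borel_measurable borel"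
    by (subst measurable_cong_sets[OF sets_design_law[symmetric] refl])
  \<comment> \<open>The design has finite support, so measurability in \<open>x\<close> alone gives
    integrability.\<close>
  from design_law_integral[OF this, where R = R]
  have "integrable (design_law R) (\<lambda>x. \<integral>y. norm (?f (x, y) * h (x, y)) \<partial>lborel)"
    by (simp only: has_bochner_integral_iff)
  then have int: "integrable (design_law R \<Otimes>\<^sub>M lborel) (\<lambda>z. ?f z * h z)"
    using inner by (intro Fubini_integrable) (auto simp: has_bochner_integral_iff)
  have "integral\<^sup>L (design_law R \<Otimes>\<^sub>M lborel) (\<lambda>z. ?f z * h z) = (\<integral>x. a x + \<sigma>\<^sup>2 * c x \<partial>design_law R)"
    using integral_fst'[OF int] inner by (simp add: has_bochner_integral_iff)
  also have "\<dots> = (\<Sum>k\<in>UNIV. a (sqrt (real CARD('d)) *\<^sub>R row k R) + \<sigma>\<^sup>2 * c (sqrt (real CARD('d)) *\<^sub>R row k R)) / real CARD('d)"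
    using design_law_integral[of "\<lambda>x. a x + \<sigma>\<^sup>2 * c x" R] by (simp add: has_bochner_integral_iff)
  finally show ?thesis
    using int unfolding gaussian_model_def design_base_def
    by (intro has_bochner_integral_density) (auto simp: has_bochner_integral_iff)
qed

lemma prob_space_gaussian_model:
  assumes "0 < \<sigma>" shows "prob_space (gaussian_model R \<sigma> w)"
proof
  have "has_bochner_integral (gaussian_model R \<sigma> w) (\<lambda>_. 1) (1 :: real)"
    using gaussian_model_integral[OF assms, of "\<lambda>_. 1" "\<lambda>_. 0" "\<lambda>_. 0" "\<lambda>_. 1" w R] by simp
  then have "(\<integral>\<^sup>+z. ennreal 1 \<partial>gaussian_model R \<sigma> w) = ennreal 1"
    by (subst nn_integral_eq_integral) (auto simp: has_bochner_integral_iff)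
  then show "emeasure (gaussian_model R \<sigma> w) (space (gaussian_model R \<sigma> w)) = 1" by simp
qed

text \<open>The two factors sqrt d cancel the uniform weight 1 / d, which is why the design points
  are scaled rows.\<close>

lemma sum_row_outer:
  fixes R :: "real^'d^'d"
  shows "(\<Sum>k\<in>UNIV. (v \<bullet> (sqrt (real CARD('d)) *\<^sub>R row k R)) * (u \<bullet> (sqrt (real CARD('d)) *\<^sub>R row k R))) / real CARD('d)
    = v \<bullet> ((transpose R ** R) *v u)"
proof -
  have "v \<bullet> ((transpose R ** R) *v u) = (R *v v) \<bullet> (R *v u)"
    by (metis dot_lmul_matrix inner_commute matrix_vector_mul_assoc transpose_matrix_vector)
  also have "\<dots> = (\<Sum>k\<in>UNIV. (v \<bullet> row k R) * (u \<bullet> row k R))"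
    unfolding inner_vec_def[of "R *v v"] by (simp add: matrix_vector_mul_component row_def inner_commute)
  finally have eq: "v \<bullet> ((transpose R ** R) *v u) = (\<Sum>k\<in>UNIV. (v \<bullet> row k R) * (u \<bullet> row k R))" .
  have "(v \<bullet> (sqrt (real CARD('d)) *\<^sub>R row k R)) * (u \<bullet> (sqrt (real CARD('d)) *\<^sub>R row k R)) / real CARD('d)
      = (v \<bullet> row k R) * (u \<bullet> row k R)" for k
    by (simp add: field_simps)
  then show ?thesis by (simp only: sum_divide_distrib eq)
qed

text \<open>Source and target share \<open>w\<close> and the noise law and differ only in the
  design. Given \<open>x\<close> the residual has mean 0 and variance
  \<open>\<sigma>\<^sup>2\<close>, so for either design the excess risk of \<open>v\<close> is a
  mean of squares that vanishes at \<open>w\<close>, and the noise condition holds with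
  equality.\<close>

lemma gaussian_model_in_problem_class:
  fixes R Q :: "real^'d^'d"
  assumes \<sigma>: "0 < \<sigma>" and w: "w \<in> W"
  shows "(gaussian_model R \<sigma> w, gaussian_model Q \<sigma> w, w)
    \<in> problem_class W (transpose R ** R) (transpose Q ** Q) \<sigma>"
proof -
  have prob: "prob_space (gaussian_model R \<sigma> w)" for R :: "real^'d^'d"
    by (rule prob_space_gaussian_model[OF \<sigma>])
  have mom: "integrable (gaussian_model R \<sigma> w) (\<lambda>z. (norm (fst z))\<^sup>2 + (snd z)\<^sup>2)" for R :: "real^'d^'d"
  proof -
    have "has_bochner_integral (gaussian_model R \<sigma> w) (\<lambda>z. (norm (fst z))\<^sup>2 + (snd z)\<^sup>2)
      ((\<Sum>k\<in>UNIV. (\<lambda>x. (norm x)\<^sup>2 + (x \<bullet> w)\<^sup>2) (sqrt (real CARD('d)) *\<^sub>R row k R) + \<sigma>\<^sup>2 * 1) / real CARD('d))"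
      by (rule gaussian_model_integral[OF \<sigma>, where b = "\<lambda>x. 2 * (x \<bullet> w)" and c = "\<lambda>_. 1"])
        (auto simp: power2_eq_square algebra_simps)
    then show ?thesis by (simp add: has_bochner_integral_iff)
  qed
  have second: "(\<integral>z. fst z $ i * fst z $ j \<partial>gaussian_model R \<sigma> w) = (transpose R ** R) $ i $ j"
    for i j and R :: "real^'d^'d"
  proof -
    have "has_bochner_integral (gaussian_model R \<sigma> w) (\<lambda>z. (axis i 1 \<bullet> fst z) * (axis j 1 \<bullet> fst z))
      ((\<Sum>k\<in>UNIV. (\<lambda>x. (axis i 1 \<bullet> x) * (axis j 1 \<bullet> x)) (sqrt (real CARD('d)) *\<^sub>R row k R) + \<sigma>\<^sup>2 * 0) / real CARD('d))"
      by (rule gaussian_model_integral[OF \<sigma>, where b = "\<lambda>_. 0" and c = "\<lambda>_. 0"]) auto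
    then have "has_bochner_integral (gaussian_model R \<sigma> w) (\<lambda>z. (axis i 1 \<bullet> fst z) * (axis j 1 \<bullet> fst z))
      (axis i 1 \<bullet> ((transpose R ** R) *v axis j 1))"
      using sum_row_outer[of "axis i 1" R "axis j 1"] by simp
    then show ?thesis
      by (simp add: has_bochner_integral_iff inner_axis' matrix_vector_mult_basis column_def)
  qed
  have risk_eq: "risk (gaussian_model R \<sigma> w) v =
      (1/2) * ((\<Sum>k\<in>UNIV. ((sqrt (real CARD('d)) *\<^sub>R row k R) \<bullet> (w - v))\<^sup>2 + \<sigma>\<^sup>2) / real CARD('d))"
    for v and R :: "real^'d^'d"
  proof -
    have "has_bochner_integral (gaussian_model R \<sigma> w) (\<lambda>z. (snd z - v \<bullet> fst z)\<^sup>2)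
      ((\<Sum>k\<in>UNIV. (\<lambda>x. (x \<bullet> (w - v))\<^sup>2) (sqrt (real CARD('d)) *\<^sub>R row k R) + \<sigma>\<^sup>2 * 1) / real CARD('d))"
      by (rule gaussian_model_integral[OF \<sigma>, where b = "\<lambda>x. 2 * (x \<bullet> (w - v))" and c = "\<lambda>_. 1"])
        (auto simp: power2_eq_square algebra_simps inner_commute)
    then show ?thesis unfolding risk_def by (simp add: has_bochner_integral_iff)
  qed
  have risk_le: "risk (gaussian_model R \<sigma> w) w \<le> risk (gaussian_model R \<sigma> w) v" for v and R :: "real^'d^'d"
    unfolding risk_eq by (intro mult_left_mono divide_right_mono sum_mono) auto
  have noise: "(\<integral>\<^sup>+z. ennreal ((snd z - fst z \<bullet> w)\<^sup>2 * (v \<bullet> fst z)\<^sup>2) \<partial>gaussian_model R \<sigma> w)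
      \<le> ennreal (\<sigma>\<^sup>2 * (v \<bullet> ((transpose R ** R) *v v)))" for v
  proof -
    have "has_bochner_integral (gaussian_model R \<sigma> w) (\<lambda>z. (snd z - fst z \<bullet> w)\<^sup>2 * (v \<bullet> fst z)\<^sup>2)
      ((\<Sum>k\<in>UNIV. 0 + \<sigma>\<^sup>2 * (\<lambda>x. (v \<bullet> x)\<^sup>2) (sqrt (real CARD('d)) *\<^sub>R row k R)) / real CARD('d))"
      by (rule gaussian_model_integral[OF \<sigma>, where b = "\<lambda>_. 0"]) auto
    moreover have "(\<Sum>k\<in>UNIV. 0 + \<sigma>\<^sup>2 * (v \<bullet> (sqrt (real CARD('d)) *\<^sub>R row k R))\<^sup>2) / real CARD('d)
        = \<sigma>\<^sup>2 * (v \<bullet> ((transpose R ** R) *v v))"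
      unfolding sum_row_outer[symmetric] power2_eq_square add_0 sum_distrib_left[symmetric] by simp
    ultimately show ?thesis
      by (subst nn_integral_eq_integral) (auto simp: has_bochner_integral_iff)
  qed
  show ?thesis
    unfolding problem_class_def using prob mom second risk_le noise w by simp
qed

section \<open>Independent samples: densities, likelihood and score\<close>

lemma PiM_density:
  assumes I: "finite I" and M: "sigma_finite_measure M"
    and f[measurable]: "f \<in> borel_measurable M" and Mf: "sigma_finite_measure (density M f)"
  shows "(\<Pi>\<^sub>M i\<in>I. density M f) = density (\<Pi>\<^sub>M i\<in>I. M) (\<lambda>x. \<Prod>i\<in>I. f (x i))"
proof -
  interpret M: sigma_finite_measure M by fact
  interpret Mf: sigma_finite_measure "density M f" by fact
  interpret P: product_sigma_finite "\<lambda>_. M" by standard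
  interpret Pf: product_sigma_finite "\<lambda>_. density M f" by standard
  show ?thesis
  proof (rule Pf.PiM_eqI[symmetric])
    show "finite I" by fact
    show "sets (density (\<Pi>\<^sub>M i\<in>I. M) (\<lambda>x. \<Prod>i\<in>I. f (x i))) = sets (\<Pi>\<^sub>M i\<in>I. density M f)"
      by (simp cong: sets_PiM_cong)
    fix A assume "\<And>i. i \<in> I \<Longrightarrow> A i \<in> sets (density M f)"
    then have A[measurable]: "\<And>i. i \<in> I \<Longrightarrow> A i \<in> sets M" by simp
    have "emeasure (density (\<Pi>\<^sub>M i\<in>I. M) (\<lambda>x. \<Prod>i\<in>I. f (x i))) (Pi\<^sub>E I A)
      = (\<integral>\<^sup>+x. (\<Prod>i\<in>I. f (x i)) * indicator (Pi\<^sub>E I A) x \<partial>(\<Pi>\<^sub>M i\<in>I. M))"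
      using I A by (subst emeasure_density) (auto intro!: sets_PiM_I_finite)
    also have "\<dots> = (\<integral>\<^sup>+x. (\<Prod>i\<in>I. f (x i) * indicator (A i) (x i)) \<partial>(\<Pi>\<^sub>M i\<in>I. M))"
    proof (rule nn_integral_cong)
      fix x assume "x \<in> space (\<Pi>\<^sub>M i\<in>I. M)"
      then have "indicator (Pi\<^sub>E I A) x = (\<Prod>i\<in>I. indicator (A i) (x i) :: ennreal)"
        using I by (auto simp: space_PiM PiE_iff indicator_def prod_zero_iff)
      then show "(\<Prod>i\<in>I. f (x i)) * indicator (Pi\<^sub>E I A) x = (\<Prod>i\<in>I. f (x i) * indicator (A i) (x i))"
        by (simp add: prod.distrib)
    qed
    also have "\<dots> = (\<Prod>i\<in>I. \<integral>\<^sup>+x. f x * indicator (A i) x \<partial>M)"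
      using I A by (subst P.product_nn_integral_prod) auto
    also have "\<dots> = (\<Prod>i\<in>I. emeasure (density M f) (A i))"
      using A by (intro prod.cong) (auto simp: emeasure_density)
    finally show "emeasure (density (\<Pi>\<^sub>M i\<in>I. M) (\<lambda>x. \<Prod>i\<in>I. f (x i))) (Pi\<^sub>E I A)
      = (\<Prod>i\<in>I. emeasure (density M f) (A i))" .
  qed
qed

text \<open>Pairs of distinct observations contribute a product of two zero means, so only the
  diagonal pairs remain. Applied to scores, this is the additivity of information.\<close>

lemma iid_sum_covariance:
  fixes f g :: "'a \<Rightarrow> real"
  assumes P: "prob_space P" and I: "finite I"
    and f: "has_bochner_integral P f 0" and g: "has_bochner_integral P g 0"
    and fg: "has_bochner_integral P (\<lambda>x. f x * g x) c"
  shows "has_bochner_integral (\<Pi>\<^sub>M i\<in>I. P) (\<lambda>x. (\<Sum>i\<in>I. f (x i)) * (\<Sum>i\<in>I. g (x i))) (real (card I) * c)"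
proof -
  interpret prob_space P by fact
  interpret product_sigma_finite "\<lambda>_. P" by standard
  have pair: "has_bochner_integral (\<Pi>\<^sub>M i\<in>I. P) (\<lambda>x. f (x i) * g (x j)) (if j = i then c else 0)"
    if ij: "i \<in> I" "j \<in> I" for i j
  proof -
    \<comment> \<open>These factors write \<open>f (x i) * g (x j)\<close> as a product over all of
      \<open>I\<close>, which treats equal and distinct indices together.\<close>
    define F where "F k x = (if k = i then f x else 1) * (if k = j then g x else 1)" for k x
    have F: "has_bochner_integral P (F k) (if k = i then if k = j then c else 0 else if k = j then 0 else 1)" for k
      using f g fg by (auto simp: F_def[abs_def] has_bochner_integral_iff prob_space)
    have eq: "(\<Prod>k\<in>I. F k (x k)) = f (x i) * g (x j)" for x
      unfolding F_def prod.distrib using I ij by simp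
    have "integrable (\<Pi>\<^sub>M i\<in>I. P) (\<lambda>x. \<Prod>k\<in>I. F k (x k))"
      using F by (intro product_integrable_prod I) (auto simp: has_bochner_integral_iff)
    moreover have "(\<integral>x. (\<Prod>k\<in>I. F k (x k)) \<partial>(\<Pi>\<^sub>M i\<in>I. P)) = (\<Prod>k\<in>I. integral\<^sup>L P (F k))"
      using F by (intro product_integral_prod I) (auto simp: has_bochner_integral_iff)
    moreover have "(\<Prod>k\<in>I. integral\<^sup>L P (F k)) = (if j = i then c else 0)"
    proof (cases "j = i")
      case True
      then have "(\<Prod>k\<in>I. integral\<^sup>L P (F k)) = (\<Prod>k\<in>I. if k = i then c else 1)"
        using F by (intro prod.cong) (auto simp: has_bochner_integral_iff)
      then show ?thesis using True I ij by simp
    next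
      case False
      have "integral\<^sup>L P (F i) = 0" using F[of i] False by (simp add: has_bochner_integral_iff)
      then show ?thesis using False I ij by (auto intro: prod_zero)
    qed
    ultimately show ?thesis by (simp add: eq has_bochner_integral_iff)
  qed
  have "has_bochner_integral (\<Pi>\<^sub>M i\<in>I. P) (\<lambda>x. \<Sum>i\<in>I. \<Sum>j\<in>I. f (x i) * g (x j)) (\<Sum>i\<in>I. \<Sum>j\<in>I. if j = i then c else 0)"
    by (intro has_bochner_integral_sum pair)
  then show ?thesis using I by (simp add: sum_product)
qed

lemma pair_measure_fst_integral:
  fixes f :: "'a \<Rightarrow> real"
  assumes "prob_space N" and f: "has_bochner_integral M f x"
  shows "has_bochner_integral (M \<Otimes>\<^sub>M N) (\<lambda>\<omega>. f (fst \<omega>)) x"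
proof -
  interpret prob_space N by fact
  have "has_bochner_integral (distr (M \<Otimes>\<^sub>M N) M fst) f x"
    using f by (simp add: distr_pair_fst)
  moreover have "f \<in> borel_measurable M"
    using f by (auto simp: has_bochner_integral_iff)
  ultimately show ?thesis
    by (simp only: has_bochner_integral_iff integrable_distr_eq[OF measurable_fst] integral_distr[OF measurable_fst])
qed

definition sample_likelihood :: "nat \<Rightarrow> real \<Rightarrow> real^'d \<Rightarrow> (nat \<Rightarrow> (real^'d) \<times> real) \<Rightarrow> real" where
  "sample_likelihood n \<sigma> w z = (\<Prod>i<n. normal_density (fst (z i) \<bullet> w) \<sigma> (snd (z i)))"

text \<open>The derivative of the logarithm of \<open>sample_likelihood\<close> at \<open>w\<close>
  in the direction \<open>v\<close>.\<close>

definition sample_score :: "nat \<Rightarrow> real \<Rightarrow> real^'d \<Rightarrow> real^'d \<Rightarrow> (nat \<Rightarrow> (real^'d) \<times> real) \<Rightarrow> real" where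
  "sample_score n \<sigma> v w z = (\<Sum>i<n. (snd (z i) - fst (z i) \<bullet> w) / \<sigma>\<^sup>2 * (v \<bullet> fst (z i)))"

lemma sample_likelihood_nonneg: "0 \<le> sample_likelihood n \<sigma> w z"
  unfolding sample_likelihood_def by (intro prod_nonneg) simp

lemma fst_snd_borel_measurable [measurable]:
  assumes [measurable]: "f \<in> borel_measurable M"
  shows "(\<lambda>x. fst (f x) :: 'a :: second_countable_topology) \<in> borel_measurable M"
    "(\<lambda>x. snd (f x) :: 'b :: second_countable_topology) \<in> borel_measurable M"
  using assms unfolding borel_prod[symmetric] by measurable

lemma sample_likelihood_measurable:
  fixes f :: "'a \<Rightarrow> real^'d"
  assumes [measurable]: "f \<in> borel_measurable M" "\<And>i. i < n \<Longrightarrow> (\<lambda>x. g x i) \<in> borel_measurable M"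
  shows "(\<lambda>x. sample_likelihood n \<sigma> (f x) (g x)) \<in> borel_measurable M"
  unfolding sample_likelihood_def by (intro borel_measurable_prod) simp

lemma sample_score_measurable:
  fixes f :: "'a \<Rightarrow> real^'d"
  assumes [measurable]: "f \<in> borel_measurable M" "\<And>i. i < n \<Longrightarrow> (\<lambda>x. g x i) \<in> borel_measurable M"
  shows "(\<lambda>x. sample_score n \<sigma> v (f x) (g x)) \<in> borel_measurable M"
  unfolding sample_score_def by (intro borel_measurable_sum) simp

text \<open>By the product rule the logarithmic derivatives of the factors add up. The curve
  \<open>w\<close> is only asked to be differentiable through its inner products, the form in which
  the likelihood depends on it.\<close>

lemma sample_likelihood_deriv:
  assumes \<sigma>: "0 < \<sigma>" and u: "\<And>x. ((\<lambda>t. x \<bullet> w t) has_real_derivative v \<bullet> x) (at t)"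
  shows "((\<lambda>t. sample_likelihood n \<sigma> (w t) z) has_real_derivative
    sample_likelihood n \<sigma> (w t) z * sample_score n \<sigma> v (w t) z) (at t)"
proof (induction n)
  case 0
  show ?case by (simp add: sample_likelihood_def sample_score_def)
next
  case (Suc n)
  let ?x = "fst (z n)" and ?y = "snd (z n)"
  have "((\<lambda>t. normal_density (?x \<bullet> w t) \<sigma> ?y) has_real_derivative
      normal_density (?x \<bullet> w t) \<sigma> ?y * ((?y - ?x \<bullet> w t) / \<sigma>\<^sup>2 * (v \<bullet> ?x))) (at t)"
    unfolding normal_density_def
    by (rule derivative_eq_intros u refl | use \<sigma> in \<open>simp add: field_simps power2_eq_square\<close>)+
  from DERIV_mult[OF Suc this] show ?case
    by (simp add: sample_likelihood_def sample_score_def algebra_simps)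
qed

lemma gaussian_score_mean:
  fixes R :: "real^'d^'d"
  assumes \<sigma>: "0 < \<sigma>"
  shows "has_bochner_integral (gaussian_model R \<sigma> w) (\<lambda>z. (snd z - fst z \<bullet> w) / \<sigma>\<^sup>2 * (v \<bullet> fst z)) 0"
proof -
  have "has_bochner_integral (gaussian_model R \<sigma> w) (\<lambda>z. (snd z - fst z \<bullet> w) / \<sigma>\<^sup>2 * (v \<bullet> fst z))
    ((\<Sum>k\<in>(UNIV::'d set). 0 + \<sigma>\<^sup>2 * 0) / real CARD('d))"
    by (rule gaussian_model_integral[OF \<sigma>, where b = "\<lambda>x. (v \<bullet> x) / \<sigma>\<^sup>2"]) auto
  then show ?thesis by simp
qed

text \<open>The squared residual has conditional mean \<open>\<sigma>\<^sup>2\<close> and stands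
  over \<open>(\<sigma>\<^sup>2)\<^sup>2\<close>, which leaves the second moment of the design over
  \<open>\<sigma>\<^sup>2\<close>.\<close>

lemma gaussian_score_covariance:
  fixes R :: "real^'d^'d"
  assumes \<sigma>: "0 < \<sigma>"
  shows "has_bochner_integral (gaussian_model R \<sigma> w)
    (\<lambda>z. ((snd z - fst z \<bullet> w) / \<sigma>\<^sup>2 * (v \<bullet> fst z)) * ((snd z - fst z \<bullet> w) / \<sigma>\<^sup>2 * (u \<bullet> fst z)))
    ((v \<bullet> ((transpose R ** R) *v u)) / \<sigma>\<^sup>2)"
proof -
  let ?r = "\<lambda>k. sqrt (real CARD('d)) *\<^sub>R row k R"
  have "has_bochner_integral (gaussian_model R \<sigma> w)
    (\<lambda>z. ((snd z - fst z \<bullet> w) / \<sigma>\<^sup>2 * (v \<bullet> fst z)) * ((snd z - fst z \<bullet> w) / \<sigma>\<^sup>2 * (u \<bullet> fst z)))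
    ((\<Sum>k\<in>UNIV. 0 + \<sigma>\<^sup>2 * (\<lambda>x. ((v \<bullet> x) * (u \<bullet> x)) / (\<sigma>\<^sup>2)\<^sup>2) (?r k)) / real CARD('d))"
    by (rule gaussian_model_integral[OF \<sigma>, where b = "\<lambda>_. 0"]) (auto simp: power2_eq_square)
  moreover have "(\<Sum>k\<in>UNIV. 0 + \<sigma>\<^sup>2 * ((v \<bullet> ?r k) * (u \<bullet> ?r k) / (\<sigma>\<^sup>2)\<^sup>2)) / real CARD('d)
      = (v \<bullet> ((transpose R ** R) *v u)) / \<sigma>\<^sup>2"
  proof -
    have "\<sigma>\<^sup>2 * ((v \<bullet> ?r k) * (u \<bullet> ?r k) / (\<sigma>\<^sup>2)\<^sup>2) = (v \<bullet> ?r k) * (u \<bullet> ?r k) / \<sigma>\<^sup>2" for k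
      using \<sigma> by (simp add: power2_eq_square)
    then show ?thesis
      unfolding sum_row_outer[symmetric] add_0 by (simp only: sum_divide_distrib[symmetric] divide_divide_eq_left mult.commute)
  qed
  ultimately show ?thesis by simp
qed

lemma sample_joint_density:
  fixes R :: "real^'d^'d"
  assumes \<sigma>: "0 < \<sigma>" and Xi: "prob_space Xi"
  shows "(\<Pi>\<^sub>M i\<in>{..<n}. gaussian_model R \<sigma> w) \<Otimes>\<^sub>M Xi
    = density ((\<Pi>\<^sub>M i\<in>{..<n}. design_base R) \<Otimes>\<^sub>M Xi) (\<lambda>\<omega>. ennreal (sample_likelihood n \<sigma> w (fst \<omega>)))"
proof -
  interpret Xi: prob_space Xi by fact
  interpret G: prob_space "gaussian_model R \<sigma> w" by (rule prob_space_gaussian_model[OF \<sigma>])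
  let ?f = "\<lambda>z. ennreal (normal_density (fst z \<bullet> w) \<sigma> (snd z))"
  have f: "?f \<in> borel_measurable (design_base R)"
    by (simp cong: measurable_cong_sets)
  have "(\<Pi>\<^sub>M i\<in>{..<n}. gaussian_model R \<sigma> w)
      = density (\<Pi>\<^sub>M i\<in>{..<n}. design_base R) (\<lambda>z. \<Prod>i<n. ?f (z i))"
    using G.sigma_finite_measure_axioms unfolding gaussian_model_def
    by (intro PiM_density sigma_finite_design_base f) auto
  also have "(\<lambda>z. \<Prod>i<n. ?f (z i)) = (\<lambda>z. ennreal (sample_likelihood n \<sigma> w z))"
    by (simp add: sample_likelihood_def prod_ennreal)
  finally have eq: "(\<Pi>\<^sub>M i\<in>{..<n}. gaussian_model R \<sigma> w)
      = density (\<Pi>\<^sub>M i\<in>{..<n}. design_base R) (\<lambda>z. ennreal (sample_likelihood n \<sigma> w z))" .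
  have "(\<lambda>z. z i) \<in> measurable (\<Pi>\<^sub>M i\<in>{..<n}. design_base R) borel" if "i < n" for i
    using measurable_component_singleton[of i "{..<n}" "\<lambda>_. design_base R"] that
    by (simp cong: measurable_cong_sets)
  then have L: "(\<lambda>z. ennreal (sample_likelihood n \<sigma> w z)) \<in> borel_measurable (\<Pi>\<^sub>M i\<in>{..<n}. design_base R)"
    by (intro measurable_compose[OF sample_likelihood_measurable measurable_ennreal]) auto
  \<comment> \<open>Giving \<open>Xi\<close> the density 1 with respect to itself makes the product
    rule for densities applicable.\<close>
  have "(\<Pi>\<^sub>M i\<in>{..<n}. gaussian_model R \<sigma> w) \<Otimes>\<^sub>M density Xi (\<lambda>_. 1)
      = density ((\<Pi>\<^sub>M i\<in>{..<n}. design_base R) \<Otimes>\<^sub>M Xi) (\<lambda>(z, \<xi>). ennreal (sample_likelihood n \<sigma> w z) * 1)"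
    unfolding eq by (intro pair_measure_density L) (auto simp: density_1 intro: Xi.sigma_finite_measure_axioms)
  then show ?thesis by (simp add: density_1 case_prod_beta')
qed

section \<open>The minimax lower bound\<close>

abbreviation param :: "real^'d^'d \<Rightarrow> ('d \<Rightarrow> real) \<Rightarrow> real^'d" where
  "param B \<theta> \<equiv> B *v (\<chi> k. \<theta> k)"

lemma inner_param_deriv:
  "((\<lambda>t. x \<bullet> param B (\<theta>(j := t))) has_real_derivative column j B \<bullet> x) (at t)"
proof -
  have eq: "x \<bullet> param B \<theta> = (\<Sum>k\<in>UNIV. \<theta> k * (column k B \<bullet> x))" for \<theta>
    by (simp add: matrix_mult_sum scalar_mult_eq_scaleR inner_sum_right inner_commute)
  have "((\<lambda>t. (\<theta>(j := t)) k * (column k B \<bullet> x)) has_real_derivative (if k = j then column k B \<bullet> x else 0)) (at t)" for k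
    by (cases "k = j") (auto intro!: derivative_eq_intros)
  then have "((\<lambda>t. \<Sum>k\<in>UNIV. (\<theta>(j := t)) k * (column k B \<bullet> x)) has_real_derivative
      (\<Sum>k\<in>UNIV. if k = j then column k B \<bullet> x else 0)) (at t)"
    by (intro DERIV_sum)
  then show ?thesis unfolding eq by simp
qed

text \<open>With w = B \<theta>, moving coordinate \<open>j\<close> moves w along column
  \<open>j\<close> of \<open>B\<close>. The scores are thus directional scores in these columns, and
  the information n S / \<sigma>^2 about w is pulled back by \<open>B\<close>.\<close>

lemma gaussian_likelihood_model:
  fixes B R :: "real^'d^'d"
  assumes \<sigma>: "0 < \<sigma>" and Xi: "prob_space Xi"
  shows "likelihood_model ((\<Pi>\<^sub>M i\<in>{..<n}. design_base R) \<Otimes>\<^sub>M Xi)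
    (\<lambda>\<theta> \<omega>. sample_likelihood n \<sigma> (param B \<theta>) (fst \<omega>))
    (\<lambda>j \<theta> \<omega>. sample_score n \<sigma> (column j B) (param B \<theta>) (fst \<omega>))
    ((real n / \<sigma>\<^sup>2) *\<^sub>R (transpose B ** (transpose R ** R) ** B))"
    (is "likelihood_model ?N ?L ?\<psi> ?J")
proof -
  interpret Xi: prob_space Xi by fact
  interpret base: sigma_finite_measure "design_base R" by (rule sigma_finite_design_base)
  interpret base: product_sigma_finite "\<lambda>_. design_base R" by standard
  interpret base_n: sigma_finite_measure "\<Pi>\<^sub>M i\<in>{..<n}. design_base R" by (rule base.sigma_finite) simp
  interpret base_pair: pair_sigma_finite "\<Pi>\<^sub>M i\<in>{..<n}. design_base R" Xi by standard
  have sample_meas: "(\<lambda>p. fst (snd p) i) \<in> borel_measurable (box_prior \<Otimes>\<^sub>M ?N)" if "i < n" for i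
  proof -
    have "(\<lambda>p. fst (snd p) i) \<in> measurable (box_prior \<Otimes>\<^sub>M ?N) (design_base R)"
      using that by (intro measurable_compose[OF measurable_compose[OF measurable_snd measurable_fst]
            measurable_component_singleton]) auto
    then show ?thesis by (subst (asm) measurable_cong_sets[OF refl sets_design_base])
  qed
  have param_meas: "(\<lambda>p. param B (fst p)) \<in> borel_measurable (box_prior \<Otimes>\<^sub>M ?N)"
  proof -
    have "(\<lambda>p. fst p k) \<in> measurable (box_prior \<Otimes>\<^sub>M ?N) cos2_prior" for k
      by (rule measurable_compose[OF measurable_fst measurable_component_singleton]) simp
    then have "(\<lambda>p. fst p k) \<in> borel_measurable (box_prior \<Otimes>\<^sub>M ?N)" for k
      by (simp cong: measurable_cong_sets)
    then show ?thesis
      unfolding matrix_mult_sum scalar_mult_eq_scaleR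
      by (intro borel_measurable_sum borel_measurable_scaleR) auto
  qed
  \<comment> \<open>Score moments are computed under the law of the sample; this carries them over
    to the likelihood-weighted base measure, with the randomization adjoined.\<close>
  have to_base: "has_bochner_integral ?N (\<lambda>\<omega>. sample_likelihood n \<sigma> w (fst \<omega>) * f (fst \<omega>)) x"
    if f: "has_bochner_integral (\<Pi>\<^sub>M i\<in>{..<n}. gaussian_model R \<sigma> w) f x" for w x and f :: "_ \<Rightarrow> real"
  proof -
    have D: "has_bochner_integral (density ?N (\<lambda>\<omega>. ennreal (sample_likelihood n \<sigma> w (fst \<omega>)))) (\<lambda>\<omega>. f (fst \<omega>)) x"
      using pair_measure_fst_integral[OF Xi f] unfolding sample_joint_density[OF \<sigma> Xi] .
    have "f \<in> borel_measurable (\<Pi>\<^sub>M i\<in>{..<n}. gaussian_model R \<sigma> w)"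
      using f by (auto simp: has_bochner_integral_iff)
    moreover have "sets (\<Pi>\<^sub>M i\<in>{..<n}. gaussian_model R \<sigma> w) = sets (\<Pi>\<^sub>M i\<in>{..<n}. design_base R)"
      by (intro sets_PiM_cong) auto
    ultimately have "f \<in> borel_measurable (\<Pi>\<^sub>M i\<in>{..<n}. design_base R)"
      by (simp cong: measurable_cong_sets)
    then have f': "(\<lambda>\<omega>. f (fst \<omega>)) \<in> borel_measurable ?N"
      by (rule measurable_compose[OF measurable_fst])
    have "(\<lambda>\<omega>. fst \<omega> i) \<in> borel_measurable ?N" if "i < n" for i
    proof -
      have "(\<lambda>\<omega>. fst \<omega> i) \<in> measurable ?N (design_base R)"
        using that by (intro measurable_compose[OF measurable_fst measurable_component_singleton]) auto
      then show ?thesis by (subst (asm) measurable_cong_sets[OF refl sets_design_base])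
    qed
    then have "(\<lambda>\<omega>. sample_likelihood n \<sigma> w (fst \<omega>)) \<in> borel_measurable ?N"
      by (intro sample_likelihood_measurable) auto
    with D f' show ?thesis
      by (simp add: has_bochner_integral_iff integrable_density integral_density sample_likelihood_nonneg)
  qed
  have G: "prob_space (gaussian_model R \<sigma> w)" for w
    by (rule prob_space_gaussian_model[OF \<sigma>])
  show ?thesis
  proof
    show "(\<lambda>p. ?L (fst p) (snd p)) \<in> borel_measurable (box_prior \<Otimes>\<^sub>M ?N)"
      by (intro sample_likelihood_measurable param_meas sample_meas)
    show "(\<lambda>p. ?\<psi> j (fst p) (snd p)) \<in> borel_measurable (box_prior \<Otimes>\<^sub>M ?N)" for j
      by (intro sample_score_measurable param_meas sample_meas)
    show "0 \<le> ?L \<theta> \<omega>" for \<theta> \<omega> by (rule sample_likelihood_nonneg)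
    show "((\<lambda>t. ?L (\<theta>(j := t)) \<omega>) has_real_derivative ?L (\<theta>(j := t)) \<omega> * ?\<psi> j (\<theta>(j := t)) \<omega>) (at t)" for \<theta> j t \<omega>
      by (intro sample_likelihood_deriv[OF \<sigma>] inner_param_deriv)
    show "continuous_on UNIV (\<lambda>t. ?\<psi> j (\<theta>(j := t)) \<omega>)" for \<theta> j \<omega>
    proof -
      have cont: "continuous_on UNIV (\<lambda>t. x \<bullet> param B (\<theta>(j := t)))" for x
        by (intro continuous_at_imp_continuous_on ballI DERIV_isCont[OF inner_param_deriv])
      show ?thesis
        unfolding sample_score_def using \<sigma>
        by (intro continuous_on_sum continuous_on_mult continuous_on_divide continuous_on_diff
            continuous_on_const cont) auto
    qed
    show "has_bochner_integral ?N (?L \<theta>) 1" for \<theta>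
    proof -
      interpret G: prob_space "\<Pi>\<^sub>M i\<in>{..<n}. gaussian_model R \<sigma> (param B \<theta>)"
        by (intro prob_space_PiM G)
      have "has_bochner_integral (\<Pi>\<^sub>M i\<in>{..<n}. gaussian_model R \<sigma> (param B \<theta>)) (\<lambda>_. 1) (1 :: real)"
        by (simp add: has_bochner_integral_iff G.prob_space)
      from to_base[OF this] show ?thesis by simp
    qed
    show "has_bochner_integral ?N (\<lambda>\<omega>. ?L \<theta> \<omega> * ?\<psi> j \<theta> \<omega>) 0" for \<theta> j
    proof (rule to_base)
      have "has_bochner_integral (\<Pi>\<^sub>M i\<in>{..<n}. gaussian_model R \<sigma> (param B \<theta>))
          (sample_score n \<sigma> (column j B) (param B \<theta>)) (\<Sum>i<n. 0)"
        unfolding sample_score_def[abs_def]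
        by (intro has_bochner_integral_sum PiM_component_integral[OF G _ gaussian_score_mean[OF \<sigma>]]) simp
      then show "has_bochner_integral (\<Pi>\<^sub>M i\<in>{..<n}. gaussian_model R \<sigma> (param B \<theta>))
          (sample_score n \<sigma> (column j B) (param B \<theta>)) 0" by simp
    qed
    show "has_bochner_integral ?N (\<lambda>\<omega>. ?L \<theta> \<omega> * (?\<psi> i \<theta> \<omega> * ?\<psi> j \<theta> \<omega>)) (?J $ i $ j)" for \<theta> i j
    proof -
      have "has_bochner_integral (\<Pi>\<^sub>M i\<in>{..<n}. gaussian_model R \<sigma> (param B \<theta>))
          (\<lambda>z. sample_score n \<sigma> (column i B) (param B \<theta>) z * sample_score n \<sigma> (column j B) (param B \<theta>) z)
          (real (card {..<n}) * ((column i B \<bullet> ((transpose R ** R) *v column j B)) / \<sigma>\<^sup>2))"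
        unfolding sample_score_def
        by (intro iid_sum_covariance G gaussian_score_mean[OF \<sigma>] gaussian_score_covariance[OF \<sigma>]) simp
      moreover have "(transpose B ** (transpose R ** R) ** B) $ i $ j = column i B \<bullet> ((transpose R ** R) *v column j B)"
      proof -
        have "(transpose B ** (transpose R ** R) ** B) $ i $ j = (transpose B ** ((transpose R ** R) ** B)) $ i $ j"
          by (simp add: matrix_mul_assoc)
        also have "\<dots> = column i B \<bullet> ((transpose R ** R) *v column j B)"
          unfolding matrix_matrix_mult_def[of "transpose B"] matrix_matrix_mult_def[of _ B]
          by (simp add: transpose_def[of B] inner_vec_def column_def matrix_vector_mult_def)
        finally show ?thesis .
      qed
      ultimately show ?thesis using to_base by fastforce
    qed
  qed
qed

text \<open>Since \<open>V\<close> is square with V V^T = pi^2 F, one has V^T F^-1 V = pi^2 I. Hence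
  K = V^T X V, where X is the matrix inverted on the left-hand side, so X^-1 = V K^-1 V^T, and
  cyclicity of the trace moves \<open>V\<close> across.\<close>

lemma trace_bound_congruence:
  fixes F S T N V :: "real^'d^'d"
  assumes N: "transpose N = N" and F: "pd_mat F" and V: "V ** transpose V = pi\<^sup>2 *\<^sub>R F"
    and K: "K = pi\<^sup>2 *\<^sub>R mat 1 + c *\<^sub>R (transpose (N ** V) ** S ** (N ** V))" and invK: "invertible K"
    and T: "transpose T = T"
  shows "frob_inner (N ** T ** N) (matrix_inv (matrix_inv F + c *\<^sub>R (N ** S ** N)))
    = trace (transpose (N ** V) ** T ** (N ** V) ** matrix_inv K)"
proof -
  let ?Fi = "matrix_inv F" and ?Ki = "matrix_inv K"
  let ?X = "?Fi + c *\<^sub>R (N ** S ** N)"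
  have F1: "F ** ?Fi = mat 1" using F by (intro matrix_inv_left_right pd_mat_invertible)
  have "V ** ((1 / pi\<^sup>2) *\<^sub>R (transpose V ** ?Fi)) = (1 / pi\<^sup>2) *\<^sub>R ((V ** transpose V) ** ?Fi)"
    by (simp add: matrix_mult_scaleR_right matrix_mul_assoc)
  also have "\<dots> = mat 1" unfolding V by (simp add: matrix_mult_scaleR_left F1)
  \<comment> \<open>A right inverse of the square matrix \<open>V\<close> is also a left inverse;
    this passes from V V^T to V^T F^-1 V.\<close>
  finally have "((1 / pi\<^sup>2) *\<^sub>R (transpose V ** ?Fi)) ** V = mat 1"
    using matrix_left_right_inverse by blast
  then have "pi\<^sup>2 *\<^sub>R (((1 / pi\<^sup>2) *\<^sub>R (transpose V ** ?Fi)) ** V) = pi\<^sup>2 *\<^sub>R mat 1" by simp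
  then have VFV: "transpose V ** ?Fi ** V = pi\<^sup>2 *\<^sub>R mat 1"
    by (simp add: matrix_mult_scaleR_left)
  have "transpose V ** ?X ** V = K"
    unfolding K matrix_transpose_mul N
    by (simp add: matrix_add_ldistrib matrix_add_rdistrib VFV matrix_mult_scaleR_left
        matrix_mult_scaleR_right matrix_mul_assoc)
  then have "transpose V ** (?X ** V ** ?Ki) = mat 1"
    using matrix_inv_left_right[OF invK] by (simp add: matrix_mul_assoc)
  \<comment> \<open>The same exchange of sides yields a right inverse of X, so its invertibility
    comes out together with the formula.\<close>
  then have "(?X ** V ** ?Ki) ** transpose V = mat 1"
    using matrix_left_right_inverse by blast
  then have inv: "matrix_inv ?X = V ** ?Ki ** transpose V"
    by (intro matrix_inv_unique) (simp add: matrix_mul_assoc)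
  have "frob_inner (N ** T ** N) (matrix_inv ?X) = trace ((N ** T ** N ** V ** ?Ki) ** transpose V)"
    unfolding inv frob_inner_def matrix_transpose_mul N T by (simp add: matrix_mul_assoc)
  also have "\<dots> = trace (transpose V ** (N ** T ** N ** V ** ?Ki))"
    by (rule trace_mul_sym)
  also have "\<dots> = trace (transpose (N ** V) ** T ** (N ** V) ** ?Ki)"
    unfolding matrix_transpose_mul N by (simp add: matrix_mul_assoc)
  finally show ?thesis .
qed

text \<open>Van Trees for the transformed estimate Q est: its target is Q B \<theta>, so C = Q B,
  and D = C K^-1 solves D K = C. The T-norm of the error is the Euclidean norm after applying
  \<open>Q\<close>, and tr (C^T D) is the stated trace.\<close>

lemma bayes_risk_lower_bound:
  fixes B R Q :: "real^'d^'d" and Xi :: "'r measure"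
  assumes \<sigma>: "0 < \<sigma>" and est: "(Xi, est) \<in> estimators n"
    and K: "K = pi\<^sup>2 *\<^sub>R mat 1 + (real n / \<sigma>\<^sup>2) *\<^sub>R (transpose B ** (transpose R ** R) ** B)"
    and invK: "invertible K"
  shows "ennreal (trace (transpose B ** (transpose Q ** Q) ** B ** matrix_inv K))
    \<le> (\<integral>\<^sup>+\<theta>. expected_loss n (transpose Q ** Q) Xi est (gaussian_model R \<sigma> (param B \<theta>)) (param B \<theta>) \<partial>box_prior)"
proof -
  let ?N = "(\<Pi>\<^sub>M i\<in>{..<n}. design_base R) \<Otimes>\<^sub>M Xi"
  have Xi: "prob_space Xi" using est by (simp add: estimators_def)
  interpret likelihood_model ?N "\<lambda>\<theta> \<omega>. sample_likelihood n \<sigma> (param B \<theta>) (fst \<omega>)"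
    "\<lambda>j \<theta> \<omega>. sample_score n \<sigma> (column j B) (param B \<theta>) (fst \<omega>)"
    "(real n / \<sigma>\<^sup>2) *\<^sub>R (transpose B ** (transpose R ** R) ** B)"
    by (rule gaussian_likelihood_model[OF \<sigma> Xi])
  have "sets ?N = sets ((\<Pi>\<^sub>M i\<in>{..<n}. (borel :: ((real^'d) \<times> real) measure)) \<Otimes>\<^sub>M Xi)"
    by (intro sets_pair_measure_cong sets_PiM_cong) auto
  then have estN: "est \<in> borel_measurable ?N"
    using est by (simp add: estimators_def cong: measurable_cong_sets)
  have lin: "(\<lambda>x. Q *v x) \<in> borel_measurable borel"
    by (intro borel_measurable_continuous_onI linear_continuous_on matrix_vector_mul_bounded_linear)
  have \<rho>: "(\<lambda>\<omega>. Q *v est \<omega>) \<in> borel_measurable ?N"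
    by (rule measurable_compose[OF estN lin])
  let ?C = "Q ** B" and ?D = "Q ** B ** matrix_inv K"
  have DK: "?D ** (pi\<^sup>2 *\<^sub>R mat 1 + (real n / \<sigma>\<^sup>2) *\<^sub>R (transpose B ** (transpose R ** R) ** B)) = ?C"
    unfolding K[symmetric] using matrix_inv_left_right[OF invK] by (simp add: matrix_mul_assoc[symmetric])
  have "trace (transpose B ** (transpose Q ** Q) ** B ** matrix_inv K) = trace (transpose ?C ** ?D)"
    by (simp add: matrix_transpose_mul matrix_mul_assoc)
  also have "\<dots> = (\<Sum>j\<in>UNIV. \<Sum>i\<in>UNIV. ?C $ i $ j * ?D $ i $ j)"
    unfolding trace_def matrix_matrix_mult_def[of "transpose ?C"] by (simp add: transpose_def)
  also have "\<dots> = (\<Sum>i\<in>UNIV. \<Sum>j\<in>UNIV. ?C $ i $ j * ?D $ i $ j)" by (rule sum.swap)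
  finally have tr: "trace (transpose B ** (transpose Q ** Q) ** B ** matrix_inv K)
      = (\<Sum>i\<in>UNIV. \<Sum>j\<in>UNIV. ?C $ i $ j * ?D $ i $ j)" .
  have loss: "expected_loss n (transpose Q ** Q) Xi est (gaussian_model R \<sigma> (param B \<theta>)) (param B \<theta>)
    = (\<integral>\<^sup>+\<omega>. ennreal (sample_likelihood n \<sigma> (param B \<theta>) (fst \<omega>) * (norm (Q *v est \<omega> - ?C *v (\<chi> j. \<theta> j)))\<^sup>2) \<partial>?N)" for \<theta>
  proof -
    have sq: "sqnorm_mat (transpose Q ** Q) (est \<omega> - param B \<theta>) = (norm (Q *v est \<omega> - ?C *v (\<chi> j. \<theta> j)))\<^sup>2" for \<omega>
    proof -
      have "sqnorm_mat (transpose Q ** Q) v = (Q *v v) \<bullet> (Q *v v)" for v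
        unfolding sqnorm_mat_def
        by (metis inner_transpose_matrix matrix_vector_mul_assoc transpose_transpose)
      then show ?thesis
        by (simp add: power2_norm_eq_inner matrix_vector_mult_diff_distrib matrix_vector_mul_assoc)
    qed
    have "(\<lambda>\<omega>. sample_likelihood n \<sigma> (param B \<theta>) (fst \<omega>)) \<in> borel_measurable ?N"
      using L_total[of \<theta>] by (auto simp: has_bochner_integral_iff)
    then show ?thesis
      unfolding expected_loss_def sq sample_joint_density[OF \<sigma> Xi]
      using \<rho> by (subst nn_integral_density) (auto simp: ennreal_mult sample_likelihood_nonneg)
  qed
  show ?thesis unfolding tr loss by (rule van_trees[OF \<rho> DK])
qed

theorem theorem1:
  fixes n :: nat and \<sigma> :: real
    and M S T :: "real^'d^'d"
    and W :: "(real^'d) set"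
  assumes "n \<ge> 1" and "\<sigma> > 0"
    and "pd_mat M" and "psd_mat S" and "psd_mat T"
    and "W = {w. w \<bullet> (M *v w) \<le> 1}"
  shows "(INF e \<in> (estimators n :: ('r measure \<times> _) set).
            SUP inst \<in> problem_class W S T \<sigma>.
              expected_loss n T (fst e) (snd e) (fst inst) (snd (snd inst)))
         \<ge> (SUP F \<in> {F. pd_mat F \<and> trace F \<le> 1 / pi^2}.
              ennreal (frob_inner (mat_inv_sqrt M ** T ** mat_inv_sqrt M)
                 (matrix_inv (matrix_inv F
                    + (real n / \<sigma>^2) *\<^sub>R (mat_inv_sqrt M ** S ** mat_inv_sqrt M)))))"
proof (intro SUP_least INF_greatest)
  fix F :: "real^'d^'d" and e :: "'r measure \<times> ((nat \<Rightarrow> (real^'d) \<times> real) \<times> 'r \<Rightarrow> real^'d)"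
  assume "F \<in> {F. pd_mat F \<and> trace F \<le> 1 / pi^2}" and e: "e \<in> estimators n"
  then have F: "pd_mat F" "trace F \<le> 1 / pi\<^sup>2" by auto
  note \<sigma> = \<open>\<sigma> > 0\<close>
  let ?SUP = "SUP inst \<in> problem_class W S T \<sigma>. expected_loss n T (fst e) (snd e) (fst inst) (snd (snd inst))"
  obtain R :: "real^'d^'d" where R: "S = transpose R ** R" using psd_factorization[OF \<open>psd_mat S\<close>] .
  obtain Q :: "real^'d^'d" where Q: "T = transpose Q ** Q" using psd_factorization[OF \<open>psd_mat T\<close>] .
  obtain V :: "real^'d^'d" where V: "V ** transpose V = pi\<^sup>2 *\<^sub>R F"
    and box: "\<forall>\<theta>. (\<forall>j. \<bar>\<theta> $ j\<bar> \<le> 1) \<longrightarrow> (V *v \<theta>) \<bullet> (V *v \<theta>) \<le> 1"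
    using pd_box_factor[OF F] .
  define N where "N = mat_inv_sqrt M"
  have N: "transpose N = N" "N ** M ** N = mat 1"
    unfolding N_def using mat_inv_sqrt_pd[OF \<open>pd_mat M\<close>] by auto
  define B where "B = N ** V"
  define K where "K = pi\<^sup>2 *\<^sub>R mat 1 + (real n / \<sigma>\<^sup>2) *\<^sub>R (transpose B ** S ** B)"
  \<comment> \<open>The share \<open>pi\<^sup>2 *\<^sub>R mat 1\<close> of the prior makes
    \<open>K\<close> positive definite even if S is singular.\<close>
  have "x = 0" if "K *v x = 0" for x
  proof -
    have "x \<bullet> (K *v x) = pi\<^sup>2 * (x \<bullet> x) + (real n / \<sigma>\<^sup>2) * (x \<bullet> (transpose B ** S ** B *v x))"
      by (simp add: K_def matrix_vector_mult_add_rdistrib scaleR_matrix_vector_assoc[symmetric] inner_add_right)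
    also have "x \<bullet> (transpose B ** S ** B *v x) = (B *v x) \<bullet> (S *v (B *v x))"
      by (metis inner_transpose_matrix matrix_vector_mul_assoc transpose_transpose)
    finally have "pi\<^sup>2 * (x \<bullet> x) + (real n / \<sigma>\<^sup>2) * ((B *v x) \<bullet> (S *v (B *v x))) = 0"
      using that by simp
    moreover have "0 \<le> (real n / \<sigma>\<^sup>2) * ((B *v x) \<bullet> (S *v (B *v x)))"
      using \<open>psd_mat S\<close> by (simp add: psd_mat_def)
    moreover have "0 \<le> pi\<^sup>2 * (x \<bullet> x)" by simp
    ultimately have "pi\<^sup>2 * (x \<bullet> x) = 0" by linarith
    then show ?thesis by simp
  qed
  then have invK: "invertible K"
    by (simp add: invertible_left_inverse matrix_left_invertible_ker)
  \<comment> \<open>Because \<open>N ** M ** N\<close> is the identity, the M-norm of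
    \<open>param B \<theta>\<close> is the Euclidean norm of V \<theta>, bounded on the
    cube.\<close>
  have inW: "param B \<theta> \<in> W" if "\<forall>j. \<bar>\<theta> j\<bar> \<le> 1" for \<theta>
  proof -
    let ?u = "V *v (\<chi> k. \<theta> k)"
    have "param B \<theta> \<bullet> (M *v param B \<theta>) = (N *v ?u) \<bullet> (M *v (N *v ?u))"
      by (simp add: B_def matrix_vector_mul_assoc)
    also have "\<dots> = ?u \<bullet> (N ** M ** N *v ?u)"
      using symmetric_matrix_inner[OF N(1)] by (metis matrix_vector_mul_assoc)
    also have "\<dots> \<le> 1" unfolding N(2) using box[rule_format, of "\<chi> k. \<theta> k"] that by simp
    finally show ?thesis using assms(6) by simp
  qed
  have "ennreal (frob_inner (N ** T ** N) (matrix_inv (matrix_inv F + (real n / \<sigma>^2) *\<^sub>R (N ** S ** N))))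
      = ennreal (trace (transpose B ** T ** B ** matrix_inv K))"
    using trace_bound_congruence[OF N(1) F(1) V K_def[unfolded B_def] invK] \<open>psd_mat T\<close>
    by (simp add: B_def psd_mat_def)
  also have "\<dots> \<le> (\<integral>\<^sup>+\<theta>. expected_loss n T (fst e) (snd e) (gaussian_model R \<sigma> (param B \<theta>)) (param B \<theta>) \<partial>box_prior)"
    using bayes_risk_lower_bound[OF \<sigma>, of "fst e" "snd e" n K B R Q] e K_def invK unfolding Q R by simp
  \<comment> \<open>An average is at most the supremum. Membership in the problem class holds for
    parameters in the cube, hence almost everywhere under the prior, which has mass 1.\<close>
  also have "\<dots> \<le> (\<integral>\<^sup>+\<theta>. ?SUP \<partial>(box_prior :: ('d \<Rightarrow> real) measure))"
  proof (rule nn_integral_mono_AE)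
    show "AE \<theta> in box_prior. expected_loss n T (fst e) (snd e) (gaussian_model R \<sigma> (param B \<theta>)) (param B \<theta>) \<le> ?SUP"
      using box_prior_supported
    proof eventually_elim
      case (elim \<theta>)
      have "(gaussian_model R \<sigma> (param B \<theta>), gaussian_model Q \<sigma> (param B \<theta>), param B \<theta>) \<in> problem_class W S T \<sigma>"
        unfolding Q R by (rule gaussian_model_in_problem_class[OF \<sigma> inW[OF elim]])
      then show ?case by (rule SUP_upper2) simp
    qed
  qed
  also have "\<dots> = ?SUP" by simp
  finally show "ennreal (frob_inner (mat_inv_sqrt M ** T ** mat_inv_sqrt M)
                 (matrix_inv (matrix_inv F
                    + (real n / \<sigma>^2) *\<^sub>R (mat_inv_sqrt M ** S ** mat_inv_sqrt M)))) \<le> ?SUP"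
    unfolding N_def .
qed

end
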